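(* For every hypergraph $H=([t],E)$ and every $0<\gamma<1/2$, the $\gamma$-noisy $H$-test is a $(t+|E|)$-function long code test with completeness $1-(t+1)\gamma|E|$ and soundness $1/2^{|E|}$.
   Context: Here $[t]=\{1,\dots,t\}$, $E$ is a set of subsets of $[t]$ (the hyperedges), and addition in $\{0,1\}^n$ is bitwise XOR. Long code: $g:\{0,1\}^n\to\{-1,1\}$ is a long code if there is $i\in[n]$ with $g(x)=(-1)^{x_i}$ for all $x$. A function $g$ is balanced if $\mathbb{E}_x g(x)=0$ for $x$ uniform in $\{0,1\}^n$. Fourier coefficients: for $f:\{0,1\}^n\to\mathbb{R}$ and $S\subseteq[n]$, $\hat f(S)=\mathbb{E}_x f(x)(-1)^{\sum_{i\in S}x_i}$. Degree-$d$ influence: $\mathrm{Inf}_i^{\le d}(f):=\sum_{S:\,i\in S,|S|\le d}\hat f(S)^2$. Degree-$d$ cross-influence of $i$ for a collection: $\mathrm{XInf}_i^{\le d}(f_1,\dots,f_K):=\max_{j\ne h}\min\{\mathrm{Inf}_i^{\le d}(f_j),\mathrm{Inf}_i^{\le d}(f_h)\}$. $K$-function long code test: a test that is given oracle access to $K$ balanced functions $g_1,\dots,g_K:\{0,1\}^n\to\{-1,1\}$ has completeness $c$ and soundness $s$ if: (1) whenever the functions $g_j$ are all equal to the same long code, the test accepts with probability $\ge c$; (2) for every $\epsilon>0$ there are $\tau=\tau(\epsilon)>0$ and $d=d(\epsilon)$ such that, if the test accepts with probability $\ge s+\epsilon$, then there is a variable $i\in[n]$ with $\mathrm{XInf}_i^{\le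 d}(g_1,\dots,g_K)\ge\tau$. Noise: for $0<\gamma<1/2$, $\mu_\gamma$ is the distribution on $\{0,1\}^n$ with $\mu_\gamma(x)=\gamma^{w(x)}(1-\gamma)^{n-w(x)}$, where $w(x)$ is the number of ones in $x$. The $\gamma$-noisy $H$-test: it has oracle access to functions $\{g^{(a)}\}_{a\in[t]\cup E}$, one for each vertex and one for each hyperedge. Choose $x_1,\dots,x_t$ uniformly and independently in $\{0,1\}^n$; for every $i\in[t]$ sample $\eta^{(i)}$ from $\mu_\gamma$ and for every $e\in E$ sample $\eta^{(e)}$ from $\mu_\gamma$, all independently. Accept if and only if for every $e\in E$, $$\prod_{i\in e}g^{(i)}\big(\eta^{(i)}+x_i\big)=g^{(e)}\Big(\eta^{(e)}+\sum_{i\in e}x_i\Big).$$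
   Formalization: Every hyperedge is assumed to have at least two vertices; if some hyperedge is empty or a single vertex, soundness fails (majority on that edge and its vertex, parity on all other functions). *)

theory Defs
  imports "HOL-Probability.Probability" "HOL-Library.Z2"
begin

text \<open>
  The cube \<open>{0,1}\<^sup>n\<close> is the set of functions \<open>nat \<Rightarrow> bit\<close> that vanish outside \<open>{1..n}\<close>; bitwise XOR
  is then pointwise addition of type \<^typ>\<open>bit\<close>. The dimension is an ordinary number because the
  constants in the soundness condition below must not depend on it. Functions on the cube are
  arbitrary outside it, and all notions below only look at their values on the cube.
\<close>

definition cube :: "nat \<Rightarrow> (nat \<Rightarrow> bit) set" where
  "cube n = {x. \<forall>i. i \<notin> {1..n} \<longrightarrow> x i = 0}"

definition weight :: "nat \<Rightarrow> (nat \<Rightarrow> bit) \<Rightarrow> nat" where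
  "weight n x = card {i \<in> {1..n}. x i = 1}"

definition uniform :: "nat \<Rightarrow> (nat \<Rightarrow> bit) pmf" where
  "uniform n = pmf_of_set (cube n)"

definition long_code :: "nat \<Rightarrow> ((nat \<Rightarrow> bit) \<Rightarrow> real) \<Rightarrow> bool" where
  "long_code n g \<longleftrightarrow> (\<exists>i\<in>{1..n}. \<forall>x\<in>cube n. g x = (-1) ^ (of_bit (x i) :: nat))"

definition balanced :: "nat \<Rightarrow> ((nat \<Rightarrow> bit) \<Rightarrow> real) \<Rightarrow> bool" where
  "balanced n g \<longleftrightarrow> measure_pmf.expectation (uniform n) g = 0"

definition fourier :: "nat \<Rightarrow> ((nat \<Rightarrow> bit) \<Rightarrow> real) \<Rightarrow> nat set \<Rightarrow> real" where
  "fourier n f S =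
     measure_pmf.expectation (uniform n) (\<lambda>x. f x * (-1) ^ (\<Sum>i\<in>S. of_bit (x i) :: nat))"

definition Infl :: "nat \<Rightarrow> nat \<Rightarrow> nat \<Rightarrow> ((nat \<Rightarrow> bit) \<Rightarrow> real) \<Rightarrow> real" where
  "Infl n d i f = (\<Sum>S | S \<subseteq> {1..n} \<and> i \<in> S \<and> card S \<le> d. (fourier n f S)\<^sup>2)"

text \<open>
  Collections of functions are indexed by a finite set \<open>J\<close>. The value is only specified if \<open>J\<close>
  has at least two elements, since otherwise the maximum ranges over the empty set.
\<close>

definition XInf :: "nat \<Rightarrow> nat \<Rightarrow> nat \<Rightarrow> 'a set \<Rightarrow> ('a \<Rightarrow> (nat \<Rightarrow> bit) \<Rightarrow> real) \<Rightarrow> real" where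
  "XInf n d i J f =
     Max {min (Infl n d i (f j)) (Infl n d i (f h)) |j h. j \<in> J \<and> h \<in> J \<and> j \<noteq> h}"

text \<open>
  A test maps the dimension and a collection of oracles to the distribution of its verdict,
  where \<^const>\<open>True\<close> means acceptance.
\<close>

type_synonym 'a test = "nat \<Rightarrow> ('a \<Rightarrow> (nat \<Rightarrow> bit) \<Rightarrow> real) \<Rightarrow> bool pmf"

definition acc_prob :: "'a test \<Rightarrow> nat \<Rightarrow> ('a \<Rightarrow> (nat \<Rightarrow> bit) \<Rightarrow> real) \<Rightarrow> real" where
  "acc_prob T n g = measure_pmf.prob (T n g) {True}"

definition admissible :: "nat \<Rightarrow> 'a set \<Rightarrow> ('a \<Rightarrow> (nat \<Rightarrow> bit) \<Rightarrow> real) \<Rightarrow> bool" where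
  "admissible n J g \<longleftrightarrow> (\<forall>j\<in>J. g j \<in> cube n \<rightarrow> {-1, 1} \<and> balanced n (g j))"

definition has_completeness :: "'a set \<Rightarrow> 'a test \<Rightarrow> real \<Rightarrow> bool" where
  "has_completeness J T c \<longleftrightarrow>
     (\<forall>n g l. admissible n J g \<longrightarrow> long_code n l \<longrightarrow> (\<forall>j\<in>J. \<forall>x\<in>cube n. g j x = l x) \<longrightarrow>
        acc_prob T n g \<ge> c)"

definition has_soundness :: "'a set \<Rightarrow> 'a test \<Rightarrow> real \<Rightarrow> bool" where
  "has_soundness J T s \<longleftrightarrow>
     (\<forall>\<epsilon>>0. \<exists>\<tau>>0. \<exists>d. \<forall>n g. admissible n J g \<longrightarrow> acc_prob T n g \<ge> s + \<epsilon> \<longrightarrow>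
        (\<exists>i\<in>{1..n}. XInf n d i J g \<ge> \<tau>))"

definition long_code_test :: "nat \<Rightarrow> 'a set \<Rightarrow> 'a test \<Rightarrow> real \<Rightarrow> real \<Rightarrow> bool" where
  "long_code_test K J T c s \<longleftrightarrow>
     finite J \<and> card J = K \<and> has_completeness J T c \<and> has_soundness J T s"

text \<open>
  The noise distribution \<open>\<mu>\<^sub>\<gamma>\<close>, given as independent bits that are 1 with probability \<open>\<gamma>\<close>;
  the lemma \<open>pmf_noise\<close> is the explicit formula.
\<close>

definition noise :: "nat \<Rightarrow> real \<Rightarrow> (nat \<Rightarrow> bit) pmf" where
  "noise n \<gamma> = Pi_pmf {1..n} 0 (\<lambda>_. map_pmf of_bool (bernoulli_pmf \<gamma>))"

lemma pmf_noise:
  assumes "x \<in> cube n" "0 \<le> \<gamma>" "\<gamma> \<le> 1"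
  shows "pmf (noise n \<gamma>) x = \<gamma> ^ weight n x * (1 - \<gamma>) ^ (n - weight n x)"
proof -
  have inj: "inj (of_bool :: bool \<Rightarrow> bit)"
    by (auto simp: inj_def of_bool_def split: if_splits)
  have *: "pmf (map_pmf of_bool (bernoulli_pmf \<gamma>)) b = (if b = (1::bit) then \<gamma> else 1 - \<gamma>)" for b
    using pmf_map_inj'[OF inj, of "bernoulli_pmf \<gamma>" True]
      pmf_map_inj'[OF inj, of "bernoulli_pmf \<gamma>" False] assms(2,3)
    by (cases b) auto
  have c: "card {i \<in> {1..n}. x i \<noteq> 1} = n - weight n x"
  proof -
    have "{i \<in> {1..n}. x i \<noteq> 1} = {1..n} - {i \<in> {1..n}. x i = 1}" by auto
    also have "card \<dots> = card {1..n} - card {i \<in> {1..n}. x i = 1}"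
      by (rule card_Diff_subset) auto
    finally show ?thesis by (simp only: weight_def card_atLeastAtMost diff_Suc_1)
  qed
  have "pmf (noise n \<gamma>) x = (\<Prod>i=1..n. if x i = 1 then \<gamma> else 1 - \<gamma>)"
    using assms(1) unfolding noise_def cube_def by (subst pmf_Pi') (auto simp: *)
  also have "\<dots> = \<gamma> ^ card {i \<in> {1..n}. x i = 1} * (1 - \<gamma>) ^ card {i \<in> {1..n}. x i \<noteq> 1}"
    by (subst prod.If_cases) (auto simp: Int_def)
  finally show ?thesis using c by (simp add: weight_def)
qed

text \<open>
  The oracles of the \<open>H\<close>-test are indexed by the disjoint sum of vertices and hyperedges:
  \<open>Inl i\<close> stands for the vertex \<open>i\<close> and \<open>Inr e\<close> for the hyperedge \<open>e\<close>.
\<close>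

definition noisy_H_test :: "nat \<Rightarrow> nat set set \<Rightarrow> real \<Rightarrow> (nat + nat set) test" where
  "noisy_H_test t E \<gamma> n g =
     do {
       x \<leftarrow> Pi_pmf {1..t} (\<lambda>_. 0) (\<lambda>_. uniform n);
       \<eta> \<leftarrow> Pi_pmf ({1..t} <+> E) (\<lambda>_. 0) (\<lambda>_. noise n \<gamma>);
       return_pmf (\<forall>e\<in>E. (\<Prod>i\<in>e. g (Inl i) (\<lambda>k. \<eta> (Inl i) k + x i k)) =
                          g (Inr e) (\<lambda>k. \<eta> (Inr e) k + (\<Sum>i\<in>e. x i k)))
     }"

end

theory Submission
  imports Defs "HOL-Library.Function_Algebras"
begin

text \<open>
  Expanding the indicator of acceptance, the acceptance probability is \<open>1 / 2 ^ card E\<close> times a sum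
  over \<open>F \<subseteq> E\<close> of expectations of products of oracles. The noise turns every oracle into its image under the noise
  operator, whose total influence is bounded independently of \<open>n\<close>. Instead of Gowers norms, the
  terms with \<open>F \<noteq> {}\<close> are bounded by Lindeberg replacement: the arguments of the oracles are distinct
  nonzero linear forms in the \<open>x\<^sub>i\<close>, hence pairwise independent, so that averaging one oracle over
  one bit of its input changes the expectation only by terms with at least three discrete derivatives.
  Since at most one oracle has a large influence on any given bit, these terms sum up to
  a small multiple of the total influence, and a balanced oracle is finally replaced by 0.
\<close>

declare add_bit_eq_xor [simp del]

section \<open>Averages over finite sets\<close>

text \<open>A finite sum instead of an expectation over a \<open>pmf\<close>, so that averages can
  be exchanged and expanded without integrability conditions.\<close>

definition avg :: "'a set \<Rightarrow> ('a \<Rightarrow> real) \<Rightarrow> real" where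
  "avg A f = (\<Sum>x\<in>A. f x) / card A"

lemma avg_cong: "(\<And>x. x \<in> A \<Longrightarrow> f x = g x) \<Longrightarrow> avg A f = avg A g"
  by (simp add: avg_def)

lemma avg_add: "avg A (\<lambda>x. f x + g x) = avg A f + avg A g"
  by (simp add: avg_def sum.distrib add_divide_distrib)

lemma avg_diff: "avg A (\<lambda>x. f x - g x) = avg A f - avg A g"
  by (simp add: avg_def sum_subtractf diff_divide_distrib)

lemma avg_minus: "avg A (\<lambda>x. - f x) = - avg A f"
  by (simp add: avg_def sum_negf)

lemma avg_cmult: "avg A (\<lambda>x. c * f x) = c * avg A f"
  by (simp add: avg_def sum_distrib_left)

lemma avg_multc: "avg A (\<lambda>x. f x * c) = avg A f * c"
  by (simp add: avg_def sum_distrib_right)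

lemma avg_sum: "avg A (\<lambda>x. \<Sum>i\<in>I. f i x) = (\<Sum>i\<in>I. avg A (f i))"
proof -
  have "(\<Sum>x\<in>A. \<Sum>i\<in>I. f i x) = (\<Sum>i\<in>I. \<Sum>x\<in>A. f i x)" by (rule sum.swap)
  then show ?thesis by (simp add: avg_def sum_divide_distrib)
qed

lemma avg_swap: "avg A (\<lambda>x. avg B (\<lambda>y. f x y)) = avg B (\<lambda>y. avg A (\<lambda>x. f x y))"
proof -
  have "(\<Sum>x\<in>A. \<Sum>y\<in>B. f x y) = (\<Sum>y\<in>B. \<Sum>x\<in>A. f x y)" by (rule sum.swap)
  then show ?thesis
    by (simp add: avg_def flip: sum_divide_distrib)
qed

lemma avg_mono: "(\<And>x. x \<in> A \<Longrightarrow> f x \<le> g x) \<Longrightarrow> avg A f \<le> avg A g"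
  by (auto simp: avg_def intro!: divide_right_mono sum_mono)

lemma avg_abs: "\<bar>avg A f\<bar> \<le> avg A (\<lambda>x. \<bar>f x\<bar>)"
  by (auto simp: avg_def intro!: divide_right_mono)

lemma avg_nonneg: "(\<And>x. x \<in> A \<Longrightarrow> 0 \<le> f x) \<Longrightarrow> 0 \<le> avg A f"
  by (auto simp: avg_def intro!: divide_nonneg_nonneg sum_nonneg)

lemma avg_const: "finite A \<Longrightarrow> A \<noteq> {} \<Longrightarrow> avg A (\<lambda>_. c) = c"
  by (simp add: avg_def)

text \<open>An injective self-map of a finite set is onto, so closure of \<open>A\<close> under
  translation by \<open>s\<close> already makes the translation a permutation of
  \<open>A\<close>.\<close>

lemma avg_shift:
  fixes s :: "'a :: cancel_ab_semigroup_add"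
  assumes "finite A" "\<And>x. x \<in> A \<Longrightarrow> x + s \<in> A"
  shows "avg A (\<lambda>x. f (x + s)) = avg A f"
proof -
  have inj: "inj_on (\<lambda>x. x + s) A" by (auto simp: inj_on_def)
  have "(\<lambda>x. x + s) ` A = A"
    using assms inj by (intro endo_inj_surj) auto
  with inj have "(\<Sum>x\<in>A. f (x + s)) = (\<Sum>x\<in>A. f x)"
    using sum.reindex[OF inj, of f] by simp
  then show ?thesis by (simp add: avg_def)
qed

section \<open>The cube as a group\<close>

text \<open>Generic in the entry type because it serves at two levels: one bit of a cube vector, and
  one cube vector among the \<open>t\<close> variables of a configuration.\<close>

definition single :: "nat \<Rightarrow> 'b::zero \<Rightarrow> nat \<Rightarrow> 'b" where
  "single i y = (\<lambda>j. if j = i then y else 0)"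

lemma bit_self_add [simp]: "(a::bit) + a = 0"
  by (cases a) auto

lemma fun_bit_self_add [simp]: "(x::nat \<Rightarrow> bit) + x = 0"
  by (simp add: fun_eq_iff)

lemma fun_bit_self_add_right [simp]: "(x::nat \<Rightarrow> bit) + y + y = x"
  by (simp add: add.assoc)

lemma cube_eq_PiE_dflt: "cube n = PiE_dflt {1..n} 0 (\<lambda>_. UNIV)"
  by (auto simp: cube_def PiE_dflt_def)

lemma UNIV_bit: "(UNIV :: bit set) = {0, 1}"
proof -
  have "b = 0 \<or> b = 1" for b :: bit by (cases b) auto
  then show ?thesis by blast
qed

lemma finite_cube [simp, intro]: "finite (cube n)"
  unfolding cube_eq_PiE_dflt by (rule finite_PiE_dflt) (auto simp: UNIV_bit)

lemma zero_in_cube [simp, intro]: "0 \<in> cube n"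
  by (simp add: cube_def)

lemma cube_ne [simp]: "cube n \<noteq> {}"
  using zero_in_cube by blast

lemma add_in_cube [simp, intro]: "x \<in> cube n \<Longrightarrow> y \<in> cube n \<Longrightarrow> x + y \<in> cube n"
  by (auto simp: cube_def)

lemma single_in_cube [simp, intro]: "k \<in> {1..n} \<Longrightarrow> single k b \<in> cube n"
  by (auto simp: cube_def single_def)

lemma sum_in_cube: "(\<And>i. i \<in> I \<Longrightarrow> x i \<in> cube n) \<Longrightarrow> (\<Sum>i\<in>I. x i) \<in> cube n"
  by (induction I rule: infinite_finite_induct) auto

lemma avg_cube_shift: "s \<in> cube n \<Longrightarrow> avg (cube n) (\<lambda>x. f (x + s)) = avg (cube n) f"
  by (rule avg_shift) auto

lemma expectation_uniform: "measure_pmf.expectation (uniform n) f = avg (cube n) f"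
  by (simp add: uniform_def integral_pmf_of_set avg_def)

section \<open>Averaging and differentiating in one bit, and influences\<close>

definition flip_mean :: "nat \<Rightarrow> ((nat \<Rightarrow> bit) \<Rightarrow> real) \<Rightarrow> (nat \<Rightarrow> bit) \<Rightarrow> real" where
  "flip_mean k f x = (f x + f (x + single k 1)) / 2"

text \<open>The discrete derivative in bit \<open>k\<close>. The factor 1/2 makes it the part of
  \<open>f\<close> that is odd under flipping bit \<open>k\<close>, with \<open>flip_mean\<close>
  the even part.\<close>

definition flip_diff :: "nat \<Rightarrow> ((nat \<Rightarrow> bit) \<Rightarrow> real) \<Rightarrow> (nat \<Rightarrow> bit) \<Rightarrow> real" where
  "flip_diff k f x = (f x - f (x + single k 1)) / 2"

text \<open>For \<open>k\<close> in \<open>{1..n}\<close> this is the influence without degree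
  bound; \<open>influence_eq_sum_fourier\<close> gives its Fourier form.\<close>

definition influence :: "nat \<Rightarrow> nat \<Rightarrow> ((nat \<Rightarrow> bit) \<Rightarrow> real) \<Rightarrow> real" where
  "influence n k f = avg (cube n) (\<lambda>x. (flip_diff k f x)\<^sup>2)"

lemma flip_mean_add_diff: "flip_mean k f x + flip_diff k f x = f x"
  by (simp add: flip_mean_def flip_diff_def field_simps)

lemma flip_mean_shift [simp]: "flip_mean k f (x + single k 1) = flip_mean k f x"
  by (simp add: flip_mean_def)

lemma flip_diff_shift [simp]: "flip_diff k f (x + single k 1) = - flip_diff k f x"
  by (simp add: flip_diff_def field_simps)

lemma flip_mean_bound:
  assumes "\<And>x. x \<in> cube n \<Longrightarrow> \<bar>f x\<bar> \<le> 1" "k \<in> {1..n}" "x \<in> cube n"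
  shows "\<bar>flip_mean k f x\<bar> \<le> 1"
  using assms(1)[OF assms(3)] assms(1)[of "x + single k 1"] assms(2,3)
  unfolding flip_mean_def by auto

lemma flip_diff_bound:
  assumes "\<And>x. x \<in> cube n \<Longrightarrow> \<bar>f x\<bar> \<le> 1" "k \<in> {1..n}" "x \<in> cube n"
  shows "\<bar>flip_diff k f x\<bar> \<le> 1"
  using assms(1)[OF assms(3)] assms(1)[of "x + single k 1"] assms(2,3)
  unfolding flip_diff_def by auto

lemma influence_nonneg: "0 \<le> influence n k f"
  by (simp add: influence_def avg_nonneg)

text \<open>Flips commute, so the derivative of the mean is the mean of two translates of the
  derivative. Convexity of the square and translation invariance do the rest.\<close>

lemma influence_flip_mean_le:
  assumes "j \<in> {1..n}"
  shows "influence n k (flip_mean j f) \<le> influence n k f"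
proof -
  let ?g = "\<lambda>x. (flip_diff k f x)\<^sup>2"
  have "influence n k (flip_mean j f) \<le> avg (cube n) (\<lambda>x. 1/2 * ?g x + 1/2 * ?g (x + single j 1))"
    unfolding influence_def
  proof (rule avg_mono)
    fix x
    have "flip_diff k (flip_mean j f) x = (flip_diff k f x + flip_diff k f (x + single j 1)) / 2"
      by (simp add: flip_diff_def flip_mean_def field_simps)
    moreover have "((u + v) / 2)\<^sup>2 \<le> 1/2 * u\<^sup>2 + 1/2 * v\<^sup>2" for u v :: real
      using zero_le_power2[of "u - v"] by (simp add: power2_eq_square field_simps)
    ultimately show "(flip_diff k (flip_mean j f) x)\<^sup>2 \<le> 1/2 * ?g x + 1/2 * ?g (x + single j 1)"
      by metis
  qed
  also have "\<dots> = influence n k f"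
    using avg_cube_shift[of "single j 1" n ?g] assms
    by (simp only: avg_add avg_cmult influence_def single_in_cube)
  finally show ?thesis .
qed

section \<open>Averaging out the bits one after another, from a function to its mean\<close>

primrec smooth :: "nat \<Rightarrow> ((nat \<Rightarrow> bit) \<Rightarrow> real) \<Rightarrow> (nat \<Rightarrow> bit) \<Rightarrow> real" where
  "smooth 0 f = f"
| "smooth (Suc m) f = flip_mean (Suc m) (smooth m f)"

lemma influence_smooth_le: "m \<le> n \<Longrightarrow> influence n k (smooth m f) \<le> influence n k f"
proof (induction m)
  case (Suc m)
  then show ?case using influence_flip_mean_le[of "Suc m" n k "smooth m f"] by simp
qed simp

lemma avg_smooth: "m \<le> n \<Longrightarrow> avg (cube n) (smooth m f) = avg (cube n) f"
proof (induction m)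
  case (Suc m)
  have "avg (cube n) (smooth (Suc m) f) =
      (avg (cube n) (smooth m f) + avg (cube n) (\<lambda>x. smooth m f (x + single (Suc m) 1))) / 2"
    by (simp add: flip_mean_def[abs_def] avg_def add_divide_distrib sum.distrib flip: sum_divide_distrib)
  then show ?case using Suc by (simp add: avg_cube_shift)
qed simp

lemma smooth_shift: "j \<in> {1..m} \<Longrightarrow> smooth m f (x + single j 1) = smooth m f x"
proof (induction m arbitrary: x)
  case (Suc m)
  show ?case
  proof (cases "j = Suc m")
    case False
    then have "j \<in> {1..m}" using Suc.prems by auto
    moreover have "x + single j 1 + single (Suc m) 1 = x + single (Suc m) 1 + single j 1"
      by (simp only: ac_simps)
    ultimately show ?thesis
      using Suc.IH[of x] Suc.IH[of "x + single (Suc m) 1"]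
      by (simp only: smooth.simps flip_mean_def)
  qed (simp only: smooth.simps flip_mean_shift)
qed simp

text \<open>Once all bits have been averaged, every single flip leaves the function unchanged, so it
  is constant on the cube; the constant is the mean because averaging preserves the mean.\<close>

lemma smooth_eq_avg:
  assumes "x \<in> cube n"
  shows "smooth n f x = avg (cube n) f"
proof -
  have const: "smooth n f x = smooth n f 0" if "m \<le> n" "x \<in> cube m" for m x
    using that
  proof (induction m arbitrary: x)
    case 0
    then have "x = 0" by (auto simp: cube_def)
    then show ?case by simp
  next
    case (Suc m)
    \<comment> \<open>Adding the top bit to itself clears it, which moves the point into the smaller
      cube of the induction hypothesis.\<close>
    define y where "y = x + single (Suc m) (x (Suc m))"
    have "y \<in> cube m"
      using Suc.prems by (auto simp: y_def cube_def single_def)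
    moreover have "smooth n f x = smooth n f y"
    proof (cases "x (Suc m) = 0")
      case True
      then have "y = x" by (auto simp: y_def single_def)
      then show ?thesis by simp
    next
      case False
      then show ?thesis using smooth_shift[of "Suc m" n f x] Suc.prems by (simp add: y_def)
    qed
    ultimately show ?case using Suc by simp
  qed
  have "avg (cube n) f = avg (cube n) (smooth n f)" by (simp add: avg_smooth)
  also have "\<dots> = avg (cube n) (\<lambda>_. smooth n f 0)" using const by (intro avg_cong) auto
  finally show ?thesis using const[of n x] assms by (simp add: avg_const)
qed

section \<open>Products of functions of linear forms\<close>

text \<open>The possible values of all query vectors together. The value 0 outside
  \<open>{1..t}\<close> matches the default of \<open>Pi_pmf\<close> in the test and keeps the set
  finite.\<close>

definition config :: "nat \<Rightarrow> nat \<Rightarrow> (nat \<Rightarrow> nat \<Rightarrow> bit) set" where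
  "config t n = PiE_dflt {1..t} 0 (\<lambda>_. cube n)"

lemma finite_config [simp, intro]: "finite (config t n)"
  by (auto simp: config_def)

lemma config_ne [simp]: "config t n \<noteq> {}"
  by (simp add: config_def)

lemma config_shift: "x \<in> config t n \<Longrightarrow> i \<in> {1..t} \<Longrightarrow> y \<in> cube n \<Longrightarrow> x + single i y \<in> config t n"
  by (auto simp: config_def PiE_dflt_def single_def)

lemma avg_config_shift:
  "i \<in> {1..t} \<Longrightarrow> y \<in> cube n \<Longrightarrow>
    avg (config t n) (\<lambda>x. f (x + single i y)) = avg (config t n) f"
  by (rule avg_shift) (auto intro: config_shift)

text \<open>\<open>L a\<close> is the support of a linear form over the field with two elements. The
  forms are nonzero and distinct, hence any two of them are linearly independent; three of them need
  not be.\<close>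

locale linear_forms =
  fixes t n :: nat and J :: "'a set" and L :: "'a \<Rightarrow> nat set"
  assumes finite_J: "finite J"
    and L_subset: "a \<in> J \<Longrightarrow> L a \<subseteq> {1..t}"
    and L_nonempty: "a \<in> J \<Longrightarrow> L a \<noteq> {}"
    and inj_L: "inj_on L J"
begin

definition lin :: "'a \<Rightarrow> (nat \<Rightarrow> nat \<Rightarrow> bit) \<Rightarrow> nat \<Rightarrow> bit" where
  "lin a x = (\<Sum>i\<in>L a. x i)"

lemma lin_in_cube: "a \<in> J \<Longrightarrow> x \<in> config t n \<Longrightarrow> lin a x \<in> cube n"
  unfolding lin_def using subsetD[OF L_subset]
  by (intro sum_in_cube) (auto simp: config_def PiE_dflt_def)

lemma lin_shift: "a \<in> J \<Longrightarrow> lin a (x + single i y) = lin a x + (if i \<in> L a then y else 0)"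
  using finite_subset[OF L_subset]
  by (simp add: lin_def sum.distrib) (simp add: single_def)

text \<open>Translating variable \<open>i\<close> by a uniform \<open>y\<close> makes the argument
  of \<open>\<phi>\<close> uniform and does not affect \<open>\<psi>\<close>, so the two factors
  separate.\<close>

lemma avg_lin_mult:
  assumes "a \<in> J" "i \<in> L a"
    and "\<And>x y. x \<in> config t n \<Longrightarrow> y \<in> cube n \<Longrightarrow> \<psi> (x + single i y) = \<psi> x"
  shows "avg (config t n) (\<lambda>x. \<phi> (lin a x) * \<psi> x) = avg (cube n) \<phi> * avg (config t n) \<psi>"
proof -
  have i: "i \<in> {1..t}" using assms L_subset by blast
  \<comment> \<open>A dummy average over \<open>y\<close> is introduced, to be absorbed by a
    translation that depends on \<open>y\<close>.\<close>
  have "avg (config t n) (\<lambda>x. \<phi> (lin a x) * \<psi> x) =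
      avg (cube n) (\<lambda>y. avg (config t n) (\<lambda>x. \<phi> (lin a x) * \<psi> x))"
    by (simp add: avg_const)
  also have "\<dots> = avg (cube n) (\<lambda>y. avg (config t n) (\<lambda>x. \<phi> (y + lin a x) * \<psi> x))"
  proof (rule avg_cong)
    fix y assume y: "y \<in> cube n"
    have "avg (config t n) (\<lambda>x. \<phi> (lin a x) * \<psi> x) =
        avg (config t n) (\<lambda>x. \<phi> (lin a (x + single i y)) * \<psi> (x + single i y))"
      using avg_config_shift[OF i y, of "\<lambda>x. \<phi> (lin a x) * \<psi> x"] by simp
    also have "\<dots> = avg (config t n) (\<lambda>x. \<phi> (y + lin a x) * \<psi> x)"
      using assms y by (intro avg_cong) (simp add: lin_shift add.commute)
    finally show "avg (config t n) (\<lambda>x. \<phi> (lin a x) * \<psi> x) = \<dots>" .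
  qed
  also have "\<dots> = avg (config t n) (\<lambda>x. avg (cube n) \<phi> * \<psi> x)"
    unfolding avg_swap[of "cube n"] avg_multc
    using assms(1) by (intro avg_cong) (simp add: avg_cube_shift lin_in_cube)
  finally show ?thesis by (simp add: avg_cmult)
qed

lemma avg_lin:
  assumes "a \<in> J"
  shows "avg (config t n) (\<lambda>x. \<phi> (lin a x)) = avg (cube n) \<phi>"
proof -
  obtain i where "i \<in> L a" using L_nonempty[OF assms] by blast
  from avg_lin_mult[OF assms this, of "\<lambda>_. 1"] show ?thesis by (simp add: avg_const)
qed

text \<open>Pairwise independence: of two different supports, one contains a variable that the other
  lacks, and that variable randomizes one form alone.\<close>

lemma avg_lin_lin:
  assumes "a \<in> J" "b \<in> J" "a \<noteq> b"
  shows "avg (config t n) (\<lambda>x. \<phi> (lin a x) * \<psi> (lin b x)) = avg (cube n) \<phi> * avg (cube n) \<psi>"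
proof -
  have "L a \<noteq> L b" using assms inj_L by (auto simp: inj_on_def)
  then consider i where "i \<in> L a" "i \<notin> L b" | i where "i \<in> L b" "i \<notin> L a" by blast
  then show ?thesis
  proof cases
    case 1
    then show ?thesis
      using avg_lin_mult[of a i "\<lambda>x. \<psi> (lin b x)" \<phi>] assms by (simp add: lin_shift avg_lin)
  next
    case 2
    then show ?thesis
      using avg_lin_mult[of b i "\<lambda>x. \<phi> (lin a x)" \<psi>] assms
      by (simp add: lin_shift avg_lin mult.commute)
  qed
qed

section \<open>Lindeberg replacement of one factor by its mean\<close>

lemma avg_odd_eq_0:
  assumes "i \<in> {1..t}" "k \<in> {1..n}" "\<And>x. x \<in> config t n \<Longrightarrow> f (x + single i (single k 1)) = - f x"
  shows "avg (config t n) f = 0"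
proof -
  have "avg (config t n) f = avg (config t n) (\<lambda>x. f (x + single i (single k 1)))"
    using assms by (simp add: avg_config_shift)
  also have "\<dots> = - avg (config t n) f"
    unfolding avg_minus[symmetric] using assms(3) by (rule avg_cong)
  finally show ?thesis by simp
qed

text \<open>With at most one derivative besides the odd function \<open>h\<close>, bit
  \<open>k\<close> of some variable can be flipped so that exactly one odd factor changes sign. The
  factors \<open>flip_mean\<close> ignore the flip.\<close>

lemma avg_expanded_term_eq_0:
  assumes a0: "a0 \<in> J" and k: "k \<in> {1..n}"
    and h: "\<And>x. h (x + single k 1) = - h x"
    and I: "I \<subseteq> J - {a0}" "card I < 2"
  shows "avg (config t n) (\<lambda>x. h (lin a0 x) * ((\<Prod>a\<in>I. flip_diff k (f a) (lin a x)) *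
           (\<Prod>a\<in>J - {a0} - I. flip_mean k (f a) (lin a x)))) = 0"
proof -
  have fI: "finite I" using I finite_J finite_subset by blast
  have mean: "(\<Prod>a\<in>J - {a0} - I. flip_mean k (f a) (lin a (x + single i (single k 1)))) =
      (\<Prod>a\<in>J - {a0} - I. flip_mean k (f a) (lin a x))" for i x
    by (intro prod.cong) (auto simp: lin_shift)
  consider "I = {}" | b where "I = {b}"
    using I(2) fI by (metis One_nat_def card_0_eq card_1_singletonE less_2_cases)
  then show ?thesis
  proof cases
    case 1
    obtain i where i: "i \<in> L a0" using L_nonempty a0 by blast
    then have "i \<in> {1..t}" using L_subset a0 by blast
    then show ?thesis
      using i a0 by (rule_tac avg_odd_eq_0[OF _ k]) (simp_all only: 1 mean[unfolded 1], simp_all add: lin_shift h)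
  next
    case (2 b)
    then have b: "b \<in> J" "b \<noteq> a0" using I by auto
    then have "L a0 \<noteq> L b" using a0 inj_L by (auto simp: inj_on_def)
    \<comment> \<open>Any variable in the symmetric difference of the two supports will do.\<close>
    then obtain i where i: "i \<in> L a0 \<longleftrightarrow> i \<notin> L b" by blast
    then have "i \<in> {1..t}" using L_subset a0 b by blast
    then show ?thesis
      by (rule avg_odd_eq_0[OF _ k], unfold mean)
        (use i a0 b in \<open>cases "i \<in> L b"; simp add: 2(1) lin_shift h\<close>)
  qed
qed

text \<open>Two derivatives are kept and all other factors are bounded by 1. Weighted AM-GM splits
  the remaining product of three factors into a product of two squares and a single square, so that
  pairwise independence suffices.\<close>

lemma avg_expanded_term_bound:
  assumes a0: "a0 \<in> J" and k: "k \<in> {1..n}"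
    and f: "\<And>a x. a \<in> J - {a0} \<Longrightarrow> x \<in> cube n \<Longrightarrow> \<bar>f a x\<bar> \<le> 1"
    and I: "I \<subseteq> J - {a0}" "2 \<le> card I" and \<sigma>: "0 < \<sigma>"
    and small: "\<And>b c. b \<in> J - {a0} \<Longrightarrow> c \<in> J - {a0} \<Longrightarrow> b \<noteq> c \<Longrightarrow>
      min (influence n k (f b)) (influence n k (f c)) \<le> \<sigma>\<^sup>2"
  shows "\<bar>avg (config t n) (\<lambda>x. h (lin a0 x) * ((\<Prod>a\<in>I. flip_diff k (f a) (lin a x)) *
           (\<Prod>a\<in>J - {a0} - I. flip_mean k (f a) (lin a x))))\<bar>
         \<le> \<sigma> * (avg (cube n) (\<lambda>x. (h x)\<^sup>2) + (\<Sum>a\<in>J - {a0}. influence n k (f a)))"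
proof -
  have fI: "finite I" using I finite_J finite_subset by blast
  obtain b' c' where "b' \<in> I" "c' \<in> I" "b' \<noteq> c'"
    using I(2) fI by (metis card_2_iff' ex_card finite_subset subsetD)
  \<comment> \<open>The two indices are ordered so that \<open>b\<close> has the small
    influence.\<close>
  then obtain b c where bc: "b \<in> I" "c \<in> I" "b \<noteq> c" "influence n k (f b) \<le> \<sigma>\<^sup>2"
    using small[of b' c'] I by (metis min_def subsetD)
  have bcJ: "b \<in> J" "c \<in> J" "b \<noteq> a0" "c \<noteq> a0" using bc I by auto
  define H where "H = avg (cube n) (\<lambda>x. (h x)\<^sup>2)"
  let ?B = "\<lambda>a x. flip_diff k (f a) (lin a x)"
  have "\<bar>avg (config t n) (\<lambda>x. h (lin a0 x) * ((\<Prod>a\<in>I. ?B a x) *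
           (\<Prod>a\<in>J - {a0} - I. flip_mean k (f a) (lin a x))))\<bar>
      \<le> avg (config t n) (\<lambda>x. 1 / (2 * \<sigma>) * ((h (lin a0 x))\<^sup>2 * (?B b x)\<^sup>2) + \<sigma> / 2 * (?B c x)\<^sup>2)"
  proof (rule order_trans[OF avg_abs], rule avg_mono)
    fix x assume x: "x \<in> config t n"
    have B: "\<bar>?B a x\<bar> \<le> 1" if "a \<in> J - {a0}" for a
      using that f k x by (intro flip_diff_bound) (auto intro: lin_in_cube)
    have A: "\<bar>flip_mean k (f a) (lin a x)\<bar> \<le> 1" if "a \<in> J - {a0}" for a
      using that f k x by (intro flip_mean_bound) (auto intro: lin_in_cube)
    have A1: "\<bar>\<Prod>a\<in>J - {a0} - I. flip_mean k (f a) (lin a x)\<bar> \<le> 1"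
      unfolding abs_prod using A by (intro prod_le_1) auto
    have "(\<Prod>a\<in>I. ?B a x) = ?B b x * (?B c x * (\<Prod>a\<in>I - {b} - {c}. ?B a x))"
      using bc fI by (simp add: prod.remove[of I b] prod.remove[of "I - {b}" c])
    moreover have "\<bar>\<Prod>a\<in>I - {b} - {c}. ?B a x\<bar> \<le> 1"
      unfolding abs_prod using B I by (intro prod_le_1) auto
    ultimately have B1: "\<bar>\<Prod>a\<in>I. ?B a x\<bar> \<le> \<bar>?B b x\<bar> * \<bar>?B c x\<bar>"
      by (simp add: abs_mult mult_left_le mult_left_mono)
    have "\<bar>h (lin a0 x) * ((\<Prod>a\<in>I. ?B a x) * (\<Prod>a\<in>J - {a0} - I. flip_mean k (f a) (lin a x)))\<bar>
        \<le> \<bar>h (lin a0 x)\<bar> * ((\<bar>?B b x\<bar> * \<bar>?B c x\<bar>) * 1)"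
      unfolding abs_mult using A1 B1 by (intro mult_left_mono mult_mono) auto
    also have "\<dots> = \<bar>h (lin a0 x) * ?B b x\<bar> * \<bar>?B c x\<bar>" by (simp add: abs_mult)
    also have "\<dots> \<le> 1 / (2 * \<sigma>) * (h (lin a0 x) * ?B b x)\<^sup>2 + \<sigma> / 2 * (?B c x)\<^sup>2"
    proof -
      \<comment> \<open>The weight is chosen so that the factor \<open>1 / \<sigma>\<close> is later
        outweighed by the influence of \<open>b\<close>, which is at most
        \<open>\<sigma>\<^sup>2\<close>.\<close>
      have "u * v \<le> 1 / (2 * \<sigma>) * u\<^sup>2 + \<sigma> / 2 * v\<^sup>2" for u v
      proof -
        have "1 / (2 * \<sigma>) * u\<^sup>2 + \<sigma> / 2 * v\<^sup>2 - u * v = (u - \<sigma> * v)\<^sup>2 / (2 * \<sigma>)"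
          using \<sigma> by (simp add: power2_diff add_divide_distrib diff_divide_distrib power_mult_distrib)
            (simp add: power2_eq_square)
        also have "\<dots> \<ge> 0" using \<sigma> by simp
        finally show ?thesis by simp
      qed
      from this[of "\<bar>h (lin a0 x) * ?B b x\<bar>" "\<bar>?B c x\<bar>"] show ?thesis
        by (simp only: power2_abs)
    qed
    finally show "\<bar>h (lin a0 x) * ((\<Prod>a\<in>I. ?B a x) * (\<Prod>a\<in>J - {a0} - I. flip_mean k (f a) (lin a x)))\<bar>
        \<le> 1 / (2 * \<sigma>) * ((h (lin a0 x))\<^sup>2 * (?B b x)\<^sup>2) + \<sigma> / 2 * (?B c x)\<^sup>2"
      by (simp add: power_mult_distrib)
  qed
  also have "\<dots> = 1 / (2 * \<sigma>) * (H * influence n k (f b)) + \<sigma> / 2 * influence n k (f c)"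
    unfolding avg_add avg_cmult H_def influence_def
    using avg_lin_lin[OF a0 bcJ(1) bcJ(3)[symmetric], of "\<lambda>x. (h x)\<^sup>2" "\<lambda>x. (flip_diff k (f b) x)\<^sup>2"]
      avg_lin[OF bcJ(2), of "\<lambda>x. (flip_diff k (f c) x)\<^sup>2"] by simp
  also have "\<dots> \<le> 1 / (2 * \<sigma>) * (H * \<sigma>\<^sup>2) + \<sigma> / 2 * influence n k (f c)"
    using bc(4) \<sigma> by (intro add_right_mono mult_left_mono) (auto simp: H_def avg_nonneg)
  also have "\<dots> = \<sigma> / 2 * (H + influence n k (f c))"
    using \<sigma> by (simp add: field_simps power2_eq_square)
  also have "\<dots> \<le> \<sigma> * (H + influence n k (f c))"
    using \<sigma> by (intro mult_right_mono) (auto simp: H_def avg_nonneg influence_nonneg)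
  also have "\<dots> \<le> \<sigma> * (H + (\<Sum>a\<in>J - {a0}. influence n k (f a)))"
    using bcJ finite_J \<sigma>
    by (intro mult_left_mono add_left_mono member_le_sum) (auto simp: influence_nonneg)
  finally show ?thesis by (simp add: H_def)
qed

text \<open>Each factor other than \<open>h\<close> is split into its mean and its derivative. In
  the expanded product, \<open>I\<close> is the set of factors that contribute their derivative:
  terms with fewer than two of them vanish, the others are small.\<close>

lemma avg_odd_prod_bound:
  assumes a0: "a0 \<in> J" and k: "k \<in> {1..n}"
    and h: "\<And>x. h (x + single k 1) = - h x"
    and f: "\<And>a x. a \<in> J - {a0} \<Longrightarrow> x \<in> cube n \<Longrightarrow> \<bar>f a x\<bar> \<le> 1"
    and \<sigma>: "0 < \<sigma>"
    and small: "\<And>b c. b \<in> J - {a0} \<Longrightarrow> c \<in> J - {a0} \<Longrightarrow> b \<noteq> c \<Longrightarrow>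
      min (influence n k (f b)) (influence n k (f c)) \<le> \<sigma>\<^sup>2"
  shows "\<bar>avg (config t n) (\<lambda>x. h (lin a0 x) * (\<Prod>a\<in>J - {a0}. f a (lin a x)))\<bar>
         \<le> 2 ^ card J * (\<sigma> * (avg (cube n) (\<lambda>x. (h x)\<^sup>2) + (\<Sum>a\<in>J - {a0}. influence n k (f a))))"
    (is "_ \<le> _ * ?R")
proof -
  let ?T = "\<lambda>I x. h (lin a0 x) * ((\<Prod>a\<in>I. flip_diff k (f a) (lin a x)) *
           (\<Prod>a\<in>J - {a0} - I. flip_mean k (f a) (lin a x)))"
  have R: "0 \<le> ?R"
    using \<sigma> by (intro mult_nonneg_nonneg add_nonneg_nonneg sum_nonneg avg_nonneg influence_nonneg) auto
  have "(\<Prod>a\<in>J - {a0}. f a (lin a x)) =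
      (\<Sum>I\<in>Pow (J - {a0}). (\<Prod>a\<in>I. flip_diff k (f a) (lin a x)) *
           (\<Prod>a\<in>J - {a0} - I. flip_mean k (f a) (lin a x)))" for x
    using prod_add[of "J - {a0}" "\<lambda>a. flip_diff k (f a) (lin a x)" "\<lambda>a. flip_mean k (f a) (lin a x)"]
    by (simp add: finite_J flip_mean_add_diff add.commute[of "flip_diff _ _ _"])
  then have "avg (config t n) (\<lambda>x. h (lin a0 x) * (\<Prod>a\<in>J - {a0}. f a (lin a x))) =
      (\<Sum>I\<in>Pow (J - {a0}). avg (config t n) (?T I))"
    by (simp add: sum_distrib_left avg_sum)
  also have "\<bar>\<dots>\<bar> \<le> (\<Sum>I\<in>Pow (J - {a0}). ?R)"
  proof (rule order_trans[OF sum_abs], rule sum_mono)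
    fix I assume I: "I \<in> Pow (J - {a0})"
    show "\<bar>avg (config t n) (?T I)\<bar> \<le> ?R"
    proof (cases "card I < 2")
      case True
      then show ?thesis using avg_expanded_term_eq_0[OF a0 k, of h I f] h I R by simp
    next
      case False
      then show ?thesis using I f small by (intro avg_expanded_term_bound[OF a0 k _ _ _ \<sigma>]) auto
    qed
  qed
  also have "\<dots> = 2 ^ card (J - {a0}) * ?R" using finite_J by (simp add: card_Pow)
  also have "\<dots> \<le> 2 ^ card J * ?R"
    using R finite_J by (intro mult_right_mono power_increasing card_mono) auto
  finally show ?thesis .
qed

text \<open>The factor \<open>f a0\<close> is replaced by its mean 0 bit by bit. The cost for bit
  \<open>k\<close> is proportional to the influences of \<open>k\<close>, so the total cost is
  \<open>\<sigma>\<close> times the total influences, up to a constant.\<close>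

theorem avg_prod_bound:
  assumes a0: "a0 \<in> J"
    and f: "\<And>a x. a \<in> J \<Longrightarrow> x \<in> cube n \<Longrightarrow> \<bar>f a x\<bar> \<le> 1"
    and balanced: "avg (cube n) (f a0) = 0"
    and \<sigma>: "0 < \<sigma>"
    and small: "\<And>k b c. k \<in> {1..n} \<Longrightarrow> b \<in> J \<Longrightarrow> c \<in> J \<Longrightarrow> b \<noteq> c \<Longrightarrow>
      min (influence n k (f b)) (influence n k (f c)) \<le> \<sigma>\<^sup>2"
  shows "\<bar>avg (config t n) (\<lambda>x. \<Prod>a\<in>J. f a (lin a x))\<bar>
         \<le> 2 ^ card J * (\<sigma> * (\<Sum>a\<in>J. \<Sum>k=1..n. influence n k (f a)))"
proof -
  \<comment> \<open>The hybrid in which bits 1 to \<open>m\<close> of \<open>f a0\<close> are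
    averaged out. Passing from \<open>m\<close> to \<open>Suc m\<close> treats bit
    \<open>Suc m\<close>, which lies in \<open>{1..n}\<close> for \<open>m < n\<close>.\<close>
  define F where "F m = avg (config t n) (\<lambda>x. smooth m (f a0) (lin a0 x) *
    (\<Prod>a\<in>J - {a0}. f a (lin a x)))" for m
  have step: "\<bar>F m - F (Suc m)\<bar> \<le> 2 ^ card J * (\<sigma> * (\<Sum>a\<in>J. influence n (Suc m) (f a)))"
    if m: "m < n" for m
  proof -
    let ?h = "flip_diff (Suc m) (smooth m (f a0))"
    have "F m - F (Suc m) = avg (config t n) (\<lambda>x. ?h (lin a0 x) * (\<Prod>a\<in>J - {a0}. f a (lin a x)))"
      unfolding F_def avg_diff[symmetric]
      by (intro avg_cong) (simp add: flip_mean_def flip_diff_def field_simps)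
    also have "\<bar>\<dots>\<bar> \<le> 2 ^ card J * (\<sigma> * (avg (cube n) (\<lambda>x. (?h x)\<^sup>2) +
        (\<Sum>a\<in>J - {a0}. influence n (Suc m) (f a))))"
      using m a0 f \<sigma> small by (intro avg_odd_prod_bound) auto
    \<comment> \<open>Averaging earlier bits cannot increase the influence of bit
      \<open>Suc m\<close>, so the cost is stated for the original \<open>f a0\<close>.\<close>
    also have "\<dots> \<le> 2 ^ card J * (\<sigma> * (influence n (Suc m) (f a0) +
        (\<Sum>a\<in>J - {a0}. influence n (Suc m) (f a))))"
      using influence_smooth_le[of m n "Suc m" "f a0"] m \<sigma>
      by (intro mult_left_mono add_right_mono) (auto simp: influence_def)
    also have "\<dots> = 2 ^ card J * (\<sigma> * (\<Sum>a\<in>J. influence n (Suc m) (f a)))"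
      using finite_J a0 by (simp add: sum.remove)
    finally show ?thesis .
  qed
  have "F n = 0"
  proof -
    have "F n = avg (config t n) (\<lambda>_. 0)"
      unfolding F_def using a0 balanced by (intro avg_cong) (simp add: smooth_eq_avg lin_in_cube)
    then show ?thesis by (simp add: avg_def)
  qed
  moreover have "F 0 = avg (config t n) (\<lambda>x. \<Prod>a\<in>J. f a (lin a x))"
    using finite_J a0 by (simp add: F_def prod.remove)
  ultimately have "avg (config t n) (\<lambda>x. \<Prod>a\<in>J. f a (lin a x)) = (\<Sum>m<n. F m - F (Suc m))"
    by (simp add: sum_lessThan_telescope')
  also have "\<bar>\<dots>\<bar> \<le> (\<Sum>m<n. 2 ^ card J * (\<sigma> * (\<Sum>a\<in>J. influence n (Suc m) (f a))))"
    using step by (intro order_trans[OF sum_abs] sum_mono) auto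
  also have "\<dots> = 2 ^ card J * (\<sigma> * (\<Sum>m<n. \<Sum>a\<in>J. influence n (Suc m) (f a)))"
    by (simp add: sum_distrib_left)
  also have "(\<Sum>m<n. \<Sum>a\<in>J. influence n (Suc m) (f a)) = (\<Sum>a\<in>J. \<Sum>m<n. influence n (Suc m) (f a))"
    by (rule sum.swap)
  also have "\<dots> = (\<Sum>a\<in>J. \<Sum>k=1..n. influence n k (f a))"
    by (simp add: sum.atLeast1_atMost_eq)
  finally show ?thesis .
qed

end

section \<open>Fourier analysis and noise\<close>

definition walsh :: "nat set \<Rightarrow> (nat \<Rightarrow> bit) \<Rightarrow> real" where
  "walsh S x = (\<Prod>i\<in>S. (-1) ^ (of_bit (x i) :: nat))"

lemma fourier_eq_avg: "fourier n f S = avg (cube n) (\<lambda>x. f x * walsh S x)"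
  by (simp only: fourier_def walsh_def power_sum expectation_uniform)

lemma walsh_add: "walsh S (x + y) = walsh S x * walsh S y"
proof -
  have "(-1) ^ (of_bit (a + b) :: nat) = (-1 :: real) ^ (of_bit a :: nat) * (-1) ^ (of_bit b :: nat)" for a b
    by (cases a; cases b) auto
  then show ?thesis by (simp only: walsh_def plus_fun_apply prod.distrib)
qed

lemma walsh_single:
  assumes "finite S"
  shows "walsh S (single k 1) = (if k \<in> S then -1 else 1)"
proof -
  have "walsh S (single k 1) = (\<Prod>i\<in>S. if i = k then -1 else 1)"
    unfolding walsh_def by (intro prod.cong) (auto simp: single_def)
  then show ?thesis using assms by simp
qed

text \<open>The sum over all subsets factors over the bits, and a bit equal to 1 contributes the
  factor 1 - 1 = 0.\<close>

lemma sum_walsh: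
  assumes "x \<in> cube n"
  shows "(\<Sum>S\<in>Pow {1..n}. walsh S x) = (if x = 0 then 2 ^ n else 0)"
proof -
  have "(\<Sum>S\<in>Pow {1..n}. walsh S x) = (\<Prod>i=1..n. (-1) ^ (of_bit (x i) :: nat) + 1)"
    by (subst prod_add) (simp_all add: walsh_def)
  also have "\<dots> = (if x = 0 then 2 ^ n else 0)"
  proof (cases "x = 0")
    case False
    then obtain i where "x i \<noteq> 0" by (auto simp: fun_eq_iff)
    then have "i \<in> {1..n}" "x i = 1" using assms by (auto simp: cube_def)
    then show ?thesis using False by (intro trans[OF prod_zero]) auto
  qed simp
  finally show ?thesis .
qed

lemma card_cube: "card (cube n) = 2 ^ n"
  unfolding cube_eq_PiE_dflt by (subst card_PiE_dflt) (auto simp: UNIV_bit numeral_2_eq_2)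

text \<open>The square of a coefficient is a double average containing
  \<open>walsh S (x + y)\<close>. Summing over \<open>S\<close> leaves only \<open>y = x\<close>,
  with weight \<open>2 ^ n\<close>, the size of the cube.\<close>

theorem parseval: "(\<Sum>S\<in>Pow {1..n}. (fourier n f S)\<^sup>2) = avg (cube n) (\<lambda>x. (f x)\<^sup>2)"
proof -
  have "(fourier n f S)\<^sup>2 = avg (cube n) (\<lambda>x. avg (cube n) (\<lambda>y. f x * f y * walsh S (x + y)))" for S
    unfolding fourier_eq_avg power2_eq_square avg_multc[symmetric] unfolding avg_cmult[symmetric]
    by (simp add: walsh_add mult_ac)
  then have "(\<Sum>S\<in>Pow {1..n}. (fourier n f S)\<^sup>2) =
      avg (cube n) (\<lambda>x. avg (cube n) (\<lambda>y. f x * f y * (\<Sum>S\<in>Pow {1..n}. walsh S (x + y))))"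
    by (simp add: avg_sum sum_distrib_left)
  also have "\<dots> = avg (cube n) (\<lambda>x. (f x)\<^sup>2)"
  proof (rule avg_cong)
    fix x assume x: "x \<in> cube n"
    have "x + y = 0 \<longleftrightarrow> y = x" for y :: "nat \<Rightarrow> bit"
      by (metis add_0 fun_bit_self_add fun_bit_self_add_right add.commute)
    then have "avg (cube n) (\<lambda>y. f x * f y * (\<Sum>S\<in>Pow {1..n}. walsh S (x + y))) =
        avg (cube n) (\<lambda>y. if y = x then f x * f y * 2 ^ n else 0)"
      using x by (intro avg_cong) (simp add: sum_walsh del: One_nat_def)
    also have "\<dots> = (f x)\<^sup>2"
      using x by (simp add: avg_def card_cube power2_eq_square)
    finally show "avg (cube n) (\<lambda>y. f x * f y * (\<Sum>S\<in>Pow {1..n}. walsh S (x + y))) = (f x)\<^sup>2" .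
  qed
  finally show ?thesis .
qed

text \<open>Flipping bit \<open>k\<close> of the argument multiplies the coefficient by
  \<open>walsh S (single k 1)\<close>, that is by -1 if \<open>k\<close> is in \<open>S\<close> and
  by 1 otherwise.\<close>

lemma fourier_flip_diff:
  assumes "k \<in> {1..n}" "S \<subseteq> {1..n}"
  shows "fourier n (flip_diff k f) S = (if k \<in> S then fourier n f S else 0)"
proof -
  have fS: "finite S" using assms finite_subset by blast
  have "avg (cube n) (\<lambda>x. f (x + single k 1) * walsh S x) =
      walsh S (single k 1) * avg (cube n) (\<lambda>x. f (x + single k 1) * walsh S (x + single k 1))"
    unfolding avg_cmult[symmetric] using fS by (intro avg_cong) (simp add: walsh_add walsh_single)
  also have "\<dots> = walsh S (single k 1) * fourier n f S"
    using avg_cube_shift[of "single k 1" n "\<lambda>x. f x * walsh S x"] assms by (simp add: fourier_eq_avg)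
  finally have "avg (cube n) (\<lambda>x. f (x + single k 1) * walsh S x) = walsh S (single k 1) * fourier n f S" .
  moreover have "fourier n (flip_diff k f) S =
      1 / 2 * (fourier n f S - avg (cube n) (\<lambda>x. f (x + single k 1) * walsh S x))"
    unfolding fourier_eq_avg avg_diff[symmetric] avg_cmult[symmetric]
    by (intro avg_cong) (simp add: flip_diff_def field_simps)
  ultimately show ?thesis using fS by (cases "k \<in> S") (simp_all add: walsh_single)
qed

text \<open>Parseval's identity for the derivative. \<open>Infl\<close> is the truncation of this
  sum to sets of size at most \<open>d\<close>.\<close>

lemma influence_eq_sum_fourier:
  assumes "k \<in> {1..n}"
  shows "influence n k f = (\<Sum>S\<in>{S\<in>Pow {1..n}. k \<in> S}. (fourier n f S)\<^sup>2)"
proof -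
  have "influence n k f = (\<Sum>S\<in>Pow {1..n}. (fourier n (flip_diff k f) S)\<^sup>2)"
    by (simp only: influence_def parseval)
  also have "\<dots> = (\<Sum>S\<in>Pow {1..n}. if k \<in> S then (fourier n f S)\<^sup>2 else 0)"
    using assms by (intro sum.cong) (auto simp: fourier_flip_diff)
  also have "\<dots> = (\<Sum>S\<in>{S\<in>Pow {1..n}. k \<in> S}. (fourier n f S)\<^sup>2)"
    by (rule sum.inter_filter[symmetric]) simp
  finally show ?thesis .
qed

lemma expectation_prod_Pi_pmf_finite:
  fixes f :: "'a \<Rightarrow> 'b \<Rightarrow> real"
  assumes "finite A" "\<And>x. x \<in> A \<Longrightarrow> finite (set_pmf (p x))"
  shows "measure_pmf.expectation (Pi_pmf A d p) (\<lambda>y. \<Prod>x\<in>A. f x (y x)) =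
         (\<Prod>x\<in>A. measure_pmf.expectation (p x) (f x))"
proof -
  have fin: "finite (set_pmf (Pi_pmf A d p))"
    using assms by (auto simp: set_Pi_pmf)
  have "prob_space.indep_vars (measure_pmf (Pi_pmf A d p)) (\<lambda>_. borel) (\<lambda>x y. f x (y x)) A"
    by (intro prob_space.indep_vars_compose2[OF _ indep_vars_Pi_pmf])
      (auto simp: measure_pmf.prob_space_axioms assms)
  then have "measure_pmf.expectation (Pi_pmf A d p) (\<lambda>y. \<Prod>x\<in>A. f x (y x)) =
      (\<Prod>x\<in>A. measure_pmf.expectation (Pi_pmf A d p) (\<lambda>y. f x (y x)))"
    using assms fin
    by (intro prob_space.indep_vars_lebesgue_integral)
      (auto simp: measure_pmf.prob_space_axioms intro: integrable_measure_pmf_finite)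
  also have "\<dots> = (\<Prod>x\<in>A. measure_pmf.expectation (p x) (f x))"
  proof (rule prod.cong)
    fix x assume "x \<in> A"
    have "measure_pmf.expectation (Pi_pmf A d p) (\<lambda>y. f x (y x)) =
        measure_pmf.expectation (map_pmf (\<lambda>y. y x) (Pi_pmf A d p)) (f x)" by simp
    also have "\<dots> = measure_pmf.expectation (p x) (f x)"
      using \<open>x \<in> A\<close> assms(1) by (simp add: Pi_pmf_component)
    finally show "measure_pmf.expectation (Pi_pmf A d p) (\<lambda>y. f x (y x)) = \<dots>" .
  qed simp
  finally show ?thesis .
qed

section \<open>The noise distribution and the noise operator\<close>

lemma set_pmf_noise: "set_pmf (noise n \<gamma>) \<subseteq> cube n"
  unfolding noise_def using set_Pi_pmf_subset[of "{1..n}" 0] by (fastforce simp: cube_def)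

lemma finite_set_pmf_noise [simp]: "finite (set_pmf (noise n \<gamma>))"
  by (rule finite_subset[OF set_pmf_noise finite_cube])

lemma expectation_noise: "measure_pmf.expectation (noise n \<gamma>) f = (\<Sum>\<eta>\<in>cube n. pmf (noise n \<gamma>) \<eta> * f \<eta>)"
  using set_pmf_noise by (subst integral_measure_pmf[of "cube n"]) auto

text \<open>The noise bits are independent, and each bit in \<open>S\<close> contributes its mean
  sign, \<open>(1 - \<gamma>) - \<gamma>\<close>.\<close>

lemma expectation_noise_walsh:
  assumes "0 \<le> \<gamma>" "\<gamma> \<le> 1" "S \<subseteq> {1..n}"
  shows "measure_pmf.expectation (noise n \<gamma>) (walsh S) = (1 - 2 * \<gamma>) ^ card S"
proof -
  let ?f = "\<lambda>i (b::bit). if i \<in> S then (-1) ^ (of_bit b :: nat) else (1 :: real)"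
  have "walsh S = (\<lambda>x. \<Prod>i=1..n. ?f i (x i))"
    unfolding walsh_def using assms(3) by (intro ext prod.mono_neutral_cong_left) auto
  then have "measure_pmf.expectation (noise n \<gamma>) (walsh S) =
      (\<Prod>i=1..n. measure_pmf.expectation (map_pmf of_bool (bernoulli_pmf \<gamma>)) (?f i))"
    unfolding noise_def by (simp only:, subst expectation_prod_Pi_pmf_finite) auto
  also have "\<dots> = (\<Prod>i=1..n. if i \<in> S then 1 - 2 * \<gamma> else 1)"
    using assms by (intro prod.cong) auto
  also have "\<dots> = (1 - 2 * \<gamma>) ^ card S"
    using assms(3) by (simp add: prod.If_cases Int_absorb1)
  finally show ?thesis .
qed

text \<open>The Bonami-Beckner operator with correlation \<open>1 - 2 * \<gamma>\<close>.\<close>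

definition noise_op :: "nat \<Rightarrow> real \<Rightarrow> ((nat \<Rightarrow> bit) \<Rightarrow> real) \<Rightarrow> (nat \<Rightarrow> bit) \<Rightarrow> real" where
  "noise_op n \<gamma> g x = measure_pmf.expectation (noise n \<gamma>) (\<lambda>\<eta>. g (\<eta> + x))"

lemma noise_op_bound:
  assumes "\<And>x. x \<in> cube n \<Longrightarrow> \<bar>g x\<bar> \<le> 1" "x \<in> cube n"
  shows "\<bar>noise_op n \<gamma> g x\<bar> \<le> 1"
proof -
  have "\<bar>noise_op n \<gamma> g x\<bar> \<le> measure_pmf.expectation (noise n \<gamma>) (\<lambda>\<eta>. \<bar>g (\<eta> + x)\<bar>)"
    unfolding noise_op_def by (rule integral_abs_bound)
  also have "\<dots> \<le> measure_pmf.expectation (noise n \<gamma>) (\<lambda>_. 1)"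
    using assms set_pmf_noise[of n \<gamma>]
    by (intro integral_mono_AE) (auto simp: AE_measure_pmf_iff intro!: integrable_measure_pmf_finite)
  finally show ?thesis by simp
qed

text \<open>Characters are eigenfunctions of every translation, with eigenvalue
  \<open>walsh S \<eta>\<close>; averaging over the noise gives the eigenvalue of the noise
  operator.\<close>

lemma fourier_noise_op:
  assumes "0 \<le> \<gamma>" "\<gamma> \<le> 1" "S \<subseteq> {1..n}"
  shows "fourier n (noise_op n \<gamma> g) S = (1 - 2 * \<gamma>) ^ card S * fourier n g S"
proof -
  let ?p = "pmf (noise n \<gamma>)"
  have shift: "avg (cube n) (\<lambda>x. g (\<eta> + x) * walsh S x) = walsh S \<eta> * fourier n g S"
    if "\<eta> \<in> cube n" for \<eta>
  proof -
    have "walsh S \<eta> * walsh S \<eta> = walsh S (\<eta> + \<eta>)" by (simp only: walsh_add)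
    \<comment> \<open>The value of a character is a sign, hence its own inverse.\<close>
    then have 1: "walsh S \<eta> * walsh S \<eta> = 1" by (simp add: walsh_def)
    have "avg (cube n) (\<lambda>x. g (\<eta> + x) * walsh S x) =
        walsh S \<eta> * avg (cube n) (\<lambda>x. g (x + \<eta>) * walsh S (x + \<eta>))"
      unfolding avg_cmult[symmetric]
    proof (rule avg_cong)
      fix x
      have "walsh S \<eta> * (g (x + \<eta>) * walsh S (x + \<eta>)) =
          (walsh S \<eta> * walsh S \<eta>) * (g (x + \<eta>) * walsh S x)"
        by (simp only: walsh_add mult_ac)
      then show "g (\<eta> + x) * walsh S x = walsh S \<eta> * (g (x + \<eta>) * walsh S (x + \<eta>))"
        by (simp only: 1 mult_1 add.commute)
    qed
    then show ?thesis
      using avg_cube_shift[OF that, of "\<lambda>x. g x * walsh S x"] by (simp add: fourier_eq_avg)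
  qed
  have "fourier n (noise_op n \<gamma> g) S =
      avg (cube n) (\<lambda>x. \<Sum>\<eta>\<in>cube n. ?p \<eta> * (g (\<eta> + x) * walsh S x))"
    by (simp add: fourier_eq_avg noise_op_def expectation_noise sum_distrib_right mult.assoc)
  also have "\<dots> = (\<Sum>\<eta>\<in>cube n. ?p \<eta> * avg (cube n) (\<lambda>x. g (\<eta> + x) * walsh S x))"
    by (simp only: avg_sum avg_cmult)
  also have "\<dots> = (\<Sum>\<eta>\<in>cube n. ?p \<eta> * walsh S \<eta>) * fourier n g S"
    by (simp add: shift sum_distrib_right mult.assoc)
  also have "(\<Sum>\<eta>\<in>cube n. ?p \<eta> * walsh S \<eta>) = (1 - 2 * \<gamma>) ^ card S"
    using expectation_noise_walsh[OF assms] by (simp add: expectation_noise)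
  finally show ?thesis .
qed

text \<open>The mean is the coefficient at the empty set, which the operator multiplies by
  1.\<close>

lemma avg_noise_op:
  assumes "0 \<le> \<gamma>" "\<gamma> \<le> 1"
  shows "avg (cube n) (noise_op n \<gamma> g) = avg (cube n) g"
  using fourier_noise_op[OF assms, of "{}" n g] by (simp add: fourier_eq_avg walsh_def)

lemma sum_fourier_le_1:
  assumes "\<And>x. x \<in> cube n \<Longrightarrow> \<bar>g x\<bar> \<le> 1"
  shows "(\<Sum>S\<in>Pow {1..n}. (fourier n g S)\<^sup>2) \<le> 1"
proof -
  have "avg (cube n) (\<lambda>x. (g x)\<^sup>2) \<le> avg (cube n) (\<lambda>_. 1)"
    using assms by (intro avg_mono) (simp add: abs_square_le_1)
  then show ?thesis by (simp add: parseval avg_const del: One_nat_def)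
qed

text \<open>Sets of size at most \<open>d\<close> are not amplified and make up \<open>Infl\<close>;
  larger sets are damped by the last summand, and their squared coefficients sum to at most 1. This
  links the noisy oracles to the low-degree influences of the original ones.\<close>

lemma influence_noise_op_le:
  assumes "0 \<le> \<gamma>" "\<gamma> \<le> 1 / 2" "k \<in> {1..n}" "\<And>x. x \<in> cube n \<Longrightarrow> \<bar>g x\<bar> \<le> 1"
  shows "influence n k (noise_op n \<gamma> g) \<le> Infl n d k g + ((1 - 2 * \<gamma>)\<^sup>2) ^ d"
proof -
  let ?r = "(1 - 2 * \<gamma>)\<^sup>2" and ?P = "{S\<in>Pow {1..n}. k \<in> S}"
  have r: "0 \<le> ?r" "?r \<le> 1" using assms by (auto simp: abs_square_le_1)
  have "influence n k (noise_op n \<gamma> g) = (\<Sum>S\<in>?P. ?r ^ card S * (fourier n g S)\<^sup>2)"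
    using assms by (simp add: influence_eq_sum_fourier)
      (intro sum.cong, auto simp: fourier_noise_op power_mult_distrib simp flip: power_mult, simp add: mult.commute)
  also have "\<dots> \<le> (\<Sum>S\<in>?P. (if card S \<le> d then (fourier n g S)\<^sup>2 else 0) + ?r ^ d * (fourier n g S)\<^sup>2)"
  proof (rule sum_mono)
    fix S
    show "?r ^ card S * (fourier n g S)\<^sup>2 \<le>
        (if card S \<le> d then (fourier n g S)\<^sup>2 else 0) + ?r ^ d * (fourier n g S)\<^sup>2"
    proof (cases "card S \<le> d")
      case True
      have "?r ^ card S * (fourier n g S)\<^sup>2 \<le> 1 * (fourier n g S)\<^sup>2"
        by (intro mult_right_mono power_le_one r) auto
      then show ?thesis using True r by (simp add: add_increasing2)
    next
      case False
      then have "?r ^ card S * (fourier n g S)\<^sup>2 \<le> ?r ^ d * (fourier n g S)\<^sup>2"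
        by (intro mult_right_mono power_decreasing r) auto
      then show ?thesis using False by simp
    qed
  qed
  also have "\<dots> = Infl n d k g + ?r ^ d * (\<Sum>S\<in>?P. (fourier n g S)\<^sup>2)"
    by (simp add: sum.distrib sum_distrib_left Infl_def flip: sum.inter_filter)
  also have "(\<Sum>S\<in>?P. (fourier n g S)\<^sup>2) \<le> (\<Sum>S\<in>Pow {1..n}. (fourier n g S)\<^sup>2)"
    by (intro sum_mono2) auto
  also have "\<dots> \<le> 1" using assms(4) by (rule sum_fourier_le_1)
  finally show ?thesis using r by (simp add: mult_left_mono)
qed

text \<open>The left side is a sum of \<open>m\<close> equal terms, each dominated by a term of the
  geometric series.\<close>

lemma nat_mult_power_le:
  fixes r :: real
  assumes "0 \<le> r" "r < 1"
  shows "real m * r ^ m \<le> 1 / (1 - r)"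
proof -
  have "real m * r ^ m = (\<Sum>j<m. r ^ m)" by simp
  also have "\<dots> \<le> (\<Sum>j<m. r ^ j)" using assms by (intro sum_mono power_decreasing) auto
  also have "\<dots> = (1 - r ^ m) / (1 - r)" using assms by (simp add: sum_gp_strict)
  also have "\<dots> \<le> 1 / (1 - r)" using assms by (intro divide_right_mono) auto
  finally show ?thesis .
qed

text \<open>Exchanging the sums counts each set \<open>S\<close> with multiplicity
  \<open>card S\<close>, and the exponential damping beats this factor. The bound does not depend on
  \<open>n\<close>.\<close>

lemma total_influence_noise_op_le:
  assumes "0 < \<gamma>" "\<gamma> \<le> 1 / 2" "\<And>x. x \<in> cube n \<Longrightarrow> \<bar>g x\<bar> \<le> 1"
  shows "(\<Sum>k=1..n. influence n k (noise_op n \<gamma> g)) \<le> 1 / (1 - (1 - 2 * \<gamma>)\<^sup>2)"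
proof -
  let ?r = "(1 - 2 * \<gamma>)\<^sup>2"
  have r: "0 \<le> ?r" "?r < 1" using assms by (auto simp: abs_square_less_1)
  have "(\<Sum>k=1..n. influence n k (noise_op n \<gamma> g)) =
      (\<Sum>k=1..n. \<Sum>S\<in>Pow {1..n}. if k \<in> S then ?r ^ card S * (fourier n g S)\<^sup>2 else 0)"
  proof (rule sum.cong)
    fix k assume k: "k \<in> {1..n}"
    show "influence n k (noise_op n \<gamma> g) =
        (\<Sum>S\<in>Pow {1..n}. if k \<in> S then ?r ^ card S * (fourier n g S)\<^sup>2 else 0)"
      unfolding influence_eq_sum_fourier[OF k]
      by (subst sum.inter_filter, simp, intro sum.cong refl)
        (use assms in \<open>auto simp: fourier_noise_op power_mult_distrib simp flip: power_mult\<close>,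
          simp add: mult.commute)
  qed simp
  also have "\<dots> = (\<Sum>S\<in>Pow {1..n}. \<Sum>k=1..n. if k \<in> S then ?r ^ card S * (fourier n g S)\<^sup>2 else 0)"
    by (rule sum.swap)
  also have "\<dots> = (\<Sum>S\<in>Pow {1..n}. real (card S) * ?r ^ card S * (fourier n g S)\<^sup>2)"
    by (intro sum.cong) (auto simp: sum.If_cases Int_absorb1)
  also have "\<dots> \<le> (\<Sum>S\<in>Pow {1..n}. 1 / (1 - ?r) * (fourier n g S)\<^sup>2)"
    by (intro sum_mono mult_right_mono nat_mult_power_le r) auto
  also have "\<dots> = 1 / (1 - ?r) * (\<Sum>S\<in>Pow {1..n}. (fourier n g S)\<^sup>2)"
    by (simp add: sum_distrib_left)
  also have "\<dots> \<le> 1 / (1 - ?r) * 1"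
    using assms(3) r by (intro mult_left_mono sum_fourier_le_1) auto
  finally show ?thesis by simp
qed

section \<open>The noisy \<open>H\<close>-test\<close>

abbreviation noise_config :: "nat \<Rightarrow> nat set set \<Rightarrow> real \<Rightarrow> nat \<Rightarrow> (nat + nat set \<Rightarrow> nat \<Rightarrow> bit) pmf" where
  "noise_config t E \<gamma> n \<equiv> Pi_pmf ({1..t} <+> E) (\<lambda>_. 0) (\<lambda>_. noise n \<gamma>)"

text \<open>The decision of the test for fixed random choices, with bitwise addition written as
  addition of functions.\<close>

definition verdict :: "nat set set \<Rightarrow> (nat + nat set \<Rightarrow> (nat \<Rightarrow> bit) \<Rightarrow> real) \<Rightarrow>
    (nat \<Rightarrow> nat \<Rightarrow> bit) \<Rightarrow> (nat + nat set \<Rightarrow> nat \<Rightarrow> bit) \<Rightarrow> bool" where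
  "verdict E g x \<eta> \<longleftrightarrow> (\<forall>e\<in>E. (\<Prod>i\<in>e. g (Inl i) (\<eta> (Inl i) + x i)) =
     g (Inr e) (\<eta> (Inr e) + (\<Sum>i\<in>e. x i)))"

lemma sum_fun_apply: "(\<Sum>i\<in>I. x i) k = (\<Sum>i\<in>I. x i k)"
  for x :: "'a \<Rightarrow> 'b \<Rightarrow> 'c::comm_monoid_add"
  by (induction I rule: infinite_finite_induct) auto

text \<open>Independent uniform vectors form one uniform configuration, so their choice becomes a
  finite average, while the noise remains an expectation.\<close>

lemma acc_prob_noisy_H_test:
  "acc_prob (noisy_H_test t E \<gamma>) n g = avg (config t n) (\<lambda>x.
     measure_pmf.expectation (noise_config t E \<gamma> n) (\<lambda>\<eta>. of_bool (verdict E g x \<eta>)))"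
proof -
  have Pi: "Pi_pmf {1..t} (\<lambda>_. 0) (\<lambda>_. uniform n) = pmf_of_set (config t n)"
    unfolding uniform_def config_def zero_fun_def by (rule Pi_pmf_of_set) auto
  have ret: "pmf (return_pmf P) True = of_bool P" for P by simp
  have verdict: "(\<forall>e\<in>E. (\<Prod>i\<in>e. g (Inl i) (\<lambda>k. \<eta> (Inl i) k + x i k)) =
      g (Inr e) (\<lambda>k. \<eta> (Inr e) k + (\<Sum>i\<in>e. x i k))) \<longleftrightarrow> verdict E g x \<eta>" for x \<eta>
    by (simp add: verdict_def plus_fun_def sum_fun_apply)
  have "acc_prob (noisy_H_test t E \<gamma>) n g = pmf (noisy_H_test t E \<gamma> n g) True"
    by (simp add: acc_prob_def measure_pmf_single)
  then show ?thesis
    by (simp only: noisy_H_test_def verdict pmf_bind ret Pi)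
      (simp add: integral_pmf_of_set avg_def)
qed

context
  fixes t :: nat and E :: "nat set set" and \<gamma> :: real
  assumes E: "E \<subseteq> Pow {1..t}"
begin

lemma finite_E: "finite E"
  using E finite_subset by blast

lemma finite_edge: "e \<in> E \<Longrightarrow> finite e"
  using E finite_subset by blast

lemma finite_oracles: "finite ({1..t} <+> E)"
  by (simp add: finite_E)

lemma finite_set_noise_config: "finite (set_pmf (noise_config t E \<gamma> n))"
  by (auto simp: set_Pi_pmf finite_E)

lemma noise_config_in_cube:
  assumes "\<eta> \<in> set_pmf (noise_config t E \<gamma> n)"
  shows "\<eta> a \<in> cube n"
proof (cases "a \<in> {1..t} <+> E")
  case True
  then show ?thesis
    using assms set_pmf_noise[of n \<gamma>] by (auto simp: set_Pi_pmf finite_E PiE_dflt_def)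
next
  case False
  then have "\<eta> a = (\<lambda>_. 0)"
    using assms by (simp add: set_Pi_pmf finite_E PiE_dflt_def)
  then show ?thesis by (simp add: cube_def)
qed

lemma integrable_noise_config:
  "integrable (measure_pmf (noise_config t E \<gamma> n)) (f :: _ \<Rightarrow> real)"
  by (rule integrable_measure_pmf_finite[OF finite_set_noise_config])

section \<open>Completeness: a union bound over noise bits\<close>

lemma expectation_noise_config_bit:
  assumes "a \<in> {1..t} <+> E" "k \<in> {1..n}" "0 \<le> \<gamma>" "\<gamma> \<le> 1"
  shows "measure_pmf.expectation (noise_config t E \<gamma> n) (\<lambda>\<eta>. of_bool (\<eta> a k = 1)) = \<gamma>"
proof -
  have "measure_pmf.expectation (noise_config t E \<gamma> n) (\<lambda>\<eta>. of_bool (\<eta> a k = 1) :: real) =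
      measure_pmf.expectation (map_pmf (\<lambda>x. x k) (map_pmf (\<lambda>\<eta>. \<eta> a) (noise_config t E \<gamma> n)))
        (\<lambda>b. of_bool (b = 1))"
    by (simp only: integral_map_pmf)
  also have "\<dots> = measure_pmf.expectation (map_pmf of_bool (bernoulli_pmf \<gamma>)) (\<lambda>b::bit. of_bool (b = 1))"
    using assms(1,2) unfolding Pi_pmf_component[OF finite_oracles] noise_def
    by (simp only: if_True Pi_pmf_component[OF finite_atLeastAtMost])
  also have "\<dots> = \<gamma>" using assms by simp
  finally show ?thesis .
qed

text \<open>A long code is a homomorphism from the cube to the signs that reads only bit
  \<open>k\<close>. Without noise in that bit, both sides of every check are the sign of the sum of
  the bits \<open>x i k\<close>.\<close>

lemma verdict_long_code:
  assumes l: "\<forall>x\<in>cube n. l x = (-1) ^ (of_bit (x k) :: nat)"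
    and g: "\<forall>j\<in>{1..t} <+> E. \<forall>x\<in>cube n. g j x = l x"
    and x: "x \<in> config t n" and \<eta>: "\<eta> \<in> set_pmf (noise_config t E \<gamma> n)"
    and zero: "\<And>e a. e \<in> E \<Longrightarrow> a \<in> insert (Inr e) (Inl ` e) \<Longrightarrow> \<eta> a k = 0"
  shows "verdict E g x \<eta>"
  unfolding verdict_def
proof
  fix e assume e: "e \<in> E"
  have e': "e \<subseteq> {1..t}" using e E by blast
  have xc: "x i \<in> cube n" if "i \<in> e" for i
    using x that e' by (auto simp: config_def PiE_dflt_def)
  have \<chi>_add: "(-1::real) ^ (of_bit (a + b) :: nat) = (-1) ^ (of_bit a :: nat) * (-1) ^ (of_bit b :: nat)" for a b
    by (cases a; cases b) auto
  have "(\<Prod>i\<in>e. g (Inl i) (\<eta> (Inl i) + x i)) = (\<Prod>i\<in>e. (-1) ^ (of_bit (x i k) :: nat))"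
  proof (rule prod.cong)
    fix i assume i: "i \<in> e"
    have "\<eta> (Inl i) + x i \<in> cube n" using xc[OF i] noise_config_in_cube[OF \<eta>] by blast
    moreover have "Inl i \<in> {1..t} <+> E" using i e' by auto
    moreover have "\<eta> (Inl i) k = 0" using zero[OF e] i by blast
    ultimately show "g (Inl i) (\<eta> (Inl i) + x i) = (-1) ^ (of_bit (x i k) :: nat)"
      using l g by simp
  qed simp
  also have "\<dots> = (-1) ^ (of_bit (\<Sum>i\<in>e. x i k) :: nat)"
    using finite_edge[OF e] by (induction e rule: finite_induct) (simp_all add: \<chi>_add del: even_add odd_add)
  also have "\<dots> = g (Inr e) (\<eta> (Inr e) + (\<Sum>i\<in>e. x i))"
  proof -
    have "\<eta> (Inr e) + (\<Sum>i\<in>e. x i) \<in> cube n"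
      using xc noise_config_in_cube[OF \<eta>] by (auto intro: sum_in_cube)
    moreover have "Inr e \<in> {1..t} <+> E" using e by auto
    moreover have "\<eta> (Inr e) k = 0" using zero[OF e] by blast
    ultimately show ?thesis using l g by (simp add: sum_fun_apply)
  qed
  finally show "(\<Prod>i\<in>e. g (Inl i) (\<eta> (Inl i) + x i)) = g (Inr e) (\<eta> (Inr e) + (\<Sum>i\<in>e. x i))" .
qed

text \<open>Each check involves at most \<open>t + 1\<close> oracles, and the noise of each hits the
  relevant bit with probability \<open>\<gamma>\<close>. The bound holds for every fixed
  configuration.\<close>

lemma noisy_H_test_completeness:
  assumes "0 \<le> \<gamma>" "\<gamma> \<le> 1"
  shows "has_completeness ({1..t} <+> E) (noisy_H_test t E \<gamma>) (1 - (real t + 1) * \<gamma> * real (card E))"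
  unfolding has_completeness_def
proof (intro allI impI)
  fix n :: nat and g :: "nat + nat set \<Rightarrow> (nat \<Rightarrow> bit) \<Rightarrow> real" and l
  assume "long_code n l" and g: "\<forall>j\<in>{1..t} <+> E. \<forall>x\<in>cube n. g j x = l x"
  then obtain k where k: "k \<in> {1..n}" "\<forall>x\<in>cube n. l x = (-1) ^ (of_bit (x k) :: nat)"
    unfolding long_code_def by blast
  let ?N = "measure_pmf.expectation (noise_config t E \<gamma> n)"
  let ?A = "\<lambda>e. insert (Inr e) (Inl ` e) :: (nat + nat set) set"
  let ?c = "1 - (real t + 1) * \<gamma> * real (card E)"
  have "?c \<le> ?N (\<lambda>\<eta>. of_bool (verdict E g x \<eta>))" if x: "x \<in> config t n" for x
  proof -
    have "?N (\<lambda>\<eta>. \<Sum>e\<in>E. \<Sum>a\<in>?A e. of_bool (\<eta> a k = 1)) = (\<Sum>e\<in>E. \<Sum>a\<in>?A e. \<gamma>)"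
    proof -
      have "?N (\<lambda>\<eta>. of_bool (\<eta> a k = 1)) = \<gamma>" if "e \<in> E" "a \<in> ?A e" for e a
        using that E k assms by (intro expectation_noise_config_bit) auto
      then show ?thesis by (simp add: integrable_noise_config del: One_nat_def sum_constant)
    qed
    also have "\<dots> \<le> (\<Sum>e\<in>E. (real t + 1) * \<gamma>)"
    proof (rule sum_mono)
      fix e assume e: "e \<in> E"
      then have "card e \<le> t" using E card_mono[of "{1..t}" e] by auto
      then have "card (?A e) \<le> t + 1"
        using finite_edge[OF e] by (subst card_insert_disjoint) (auto simp: card_image)
      then have "real (card (?A e)) \<le> real t + 1" by linarith
      then show "(\<Sum>a\<in>?A e. \<gamma>) \<le> (real t + 1) * \<gamma>"
        unfolding sum_constant using assms by (intro mult_right_mono)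
    qed
    finally have "?c \<le> ?N (\<lambda>\<eta>. 1 - (\<Sum>e\<in>E. \<Sum>a\<in>?A e. of_bool (\<eta> a k = 1)))"
      by (simp add: integrable_noise_config mult_ac del: One_nat_def)
    \<comment> \<open>The union bound pointwise: one corrupted bit makes the left side nonpositive,
      and without corrupted bits the test accepts.\<close>
    also have "\<dots> \<le> ?N (\<lambda>\<eta>. of_bool (verdict E g x \<eta>))"
    proof (intro integral_mono_AE integrable_noise_config AE_pmfI)
      fix \<eta> assume \<eta>: "\<eta> \<in> set_pmf (noise_config t E \<gamma> n)"
      show "1 - (\<Sum>e\<in>E. \<Sum>a\<in>?A e. of_bool (\<eta> a k = 1)) \<le> (of_bool (verdict E g x \<eta>) :: real)"
      proof (cases "\<exists>e\<in>E. \<exists>a\<in>?A e. \<eta> a k = 1")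
        case True
        then obtain e a where ea: "e \<in> E" "a \<in> ?A e" "\<eta> a k = 1" by blast
        have "1 = (of_bool (\<eta> a k = 1) :: real)" using ea by simp
        also have "\<dots> \<le> (\<Sum>a\<in>?A e. of_bool (\<eta> a k = 1))"
          using ea finite_edge by (intro member_le_sum) auto
        also have "\<dots> \<le> (\<Sum>e\<in>E. \<Sum>a\<in>?A e. of_bool (\<eta> a k = 1))"
          using ea finite_E by (intro member_le_sum[of e E "\<lambda>e. \<Sum>a\<in>?A e. of_bool (\<eta> a k = 1)"] sum_nonneg) auto
        finally have "1 - (\<Sum>e\<in>E. \<Sum>a\<in>?A e. of_bool (\<eta> a k = 1)) \<le> (0 :: real)" by linarith
        then show ?thesis by (rule order_trans) simp
      next
        case False
        then have zero: "\<eta> a k = 0" if "e \<in> E" "a \<in> ?A e" for e a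
          using that bit_not_one_iff by blast
        have "verdict E g x \<eta>" by (rule verdict_long_code[OF k(2) g x \<eta> zero])
        moreover have "0 \<le> (\<Sum>e\<in>E. \<Sum>a\<in>?A e. of_bool (\<eta> a k = 1) :: real)"
          by (intro sum_nonneg) auto
        ultimately show ?thesis by simp
      qed
    qed
    finally show ?thesis .
  qed
  then have "avg (config t n) (\<lambda>_. ?c) \<le> acc_prob (noisy_H_test t E \<gamma>) n g"
    unfolding acc_prob_noisy_H_test by (rule avg_mono)
  then show "?c \<le> acc_prob (noisy_H_test t E \<gamma>) n g" by (simp add: avg_const)
qed

section \<open>Expansion of the acceptance probability over sets of edges\<close>

definition odd_vertices :: "nat set set \<Rightarrow> nat set" where
  "odd_vertices F = {i\<in>{1..t}. odd (card {e\<in>F. i \<in> e})}"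

text \<open>The support of the linear form at which an oracle is queried, before noise is
  added.\<close>

definition vertices_of :: "nat + nat set \<Rightarrow> nat set" where
  "vertices_of = case_sum (\<lambda>i. {i}) id"

lemma vertices_of_subset:
  assumes "a \<in> {1..t} <+> E"
  shows "vertices_of a \<subseteq> {1..t}"
proof (cases a)
  case (Inr e)
  then have "e \<in> E" using assms by blast
  then show ?thesis using E by (auto simp: vertices_of_def Inr)
qed (use assms in \<open>auto simp: vertices_of_def\<close>)

text \<open>Vertex \<open>i\<close> occurs once for each edge of \<open>F\<close> containing it, and
  squares of signs cancel, so only the parity counts. Thus \<open>odd_vertices F\<close> is the sum
  of the edges of \<open>F\<close> modulo 2.\<close>

lemma prod_edges:
  fixes u :: "nat \<Rightarrow> real"
  assumes F: "F \<subseteq> E" and u: "\<And>i. i \<in> {1..t} \<Longrightarrow> u i \<in> {-1, 1}"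
  shows "(\<Prod>e\<in>F. \<Prod>i\<in>e. u i) = (\<Prod>i\<in>odd_vertices F. u i)"
proof -
  have finF: "finite F" using F finite_E finite_subset by blast
  have "(\<Prod>e\<in>F. \<Prod>i\<in>e. u i) = (\<Prod>e\<in>F. \<Prod>i\<in>{1..t}. if i \<in> e then u i else 1)"
    using F E by (intro prod.cong refl prod.mono_neutral_cong_left) auto
  also have "\<dots> = (\<Prod>i\<in>{1..t}. \<Prod>e\<in>F. if i \<in> e then u i else 1)" by (rule prod.swap)
  also have "\<dots> = (\<Prod>i\<in>{1..t}. u i ^ card {e\<in>F. i \<in> e})"
    using finF by (intro prod.cong) (simp_all add: prod.inter_filter[symmetric])
  also have "\<dots> = (\<Prod>i\<in>{1..t}. if odd (card {e\<in>F. i \<in> e}) then u i else 1)"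
  proof (rule prod.cong)
    fix i assume "i \<in> {1..t}"
    then consider "u i = -1" | "u i = 1" using u by blast
    then show "u i ^ card {e\<in>F. i \<in> e} = (if odd (card {e\<in>F. i \<in> e}) then u i else 1)"
      by cases auto
  qed simp
  also have "\<dots> = (\<Prod>i\<in>odd_vertices F. u i)"
    unfolding odd_vertices_def by (rule prod.inter_filter[symmetric]) simp
  finally show ?thesis .
qed

text \<open>For signs, the indicator of \<open>a = b\<close> is \<open>(a * b + 1) / 2\<close>; the
  product over the edges is then expanded over subsets \<open>F\<close>. A vertex oracle gives the
  same answer in all checks, so its repeated occurrences cancel in pairs.\<close>

lemma of_bool_verdict:
  assumes g: "admissible n ({1..t} <+> E) g"
    and x: "x \<in> config t n" and \<eta>: "\<eta> \<in> set_pmf (noise_config t E \<gamma> n)"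
  shows "(of_bool (verdict E g x \<eta>) :: real) = (\<Sum>F\<in>Pow E.
    \<Prod>a\<in>odd_vertices F <+> F. g a (\<eta> a + (\<Sum>i\<in>vertices_of a. x i))) / 2 ^ card E"
proof -
  define u where "u a = g a (\<eta> a + (\<Sum>i\<in>vertices_of a. x i))" for a
  have u: "u a \<in> {-1, 1}" if a: "a \<in> {1..t} <+> E" for a
  proof -
    have "(\<Sum>i\<in>vertices_of a. x i) \<in> cube n"
      using x vertices_of_subset[OF a] by (intro sum_in_cube) (auto simp: config_def PiE_dflt_def)
    then show ?thesis
      using g a noise_config_in_cube[OF \<eta>, of a] unfolding u_def admissible_def by blast
  qed
  have uv: "u (Inl i) \<in> {-1, 1}" if "i \<in> {1..t}" for i using u that by blast
  have ue: "u (Inr e) \<in> {-1, 1}" if "e \<in> E" for e using u that by blast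
  let ?Z = "\<lambda>e. (\<Prod>i\<in>e. u (Inl i)) * u (Inr e)"
  have Z: "of_bool ((\<Prod>i\<in>e. u (Inl i)) = u (Inr e)) = (?Z e + 1) / 2" if e: "e \<in> E" for e
  proof -
    have "(\<Prod>i\<in>e. u (Inl i)) \<in> {-1, 1}"
    proof -
      have "\<forall>i\<in>e. u (Inl i) \<in> {-1, 1}" using uv e E by blast
      then show ?thesis using finite_edge[OF e]
        by (induction e rule: infinite_finite_induct) auto
    qed
    then show ?thesis using ue[OF e] by auto
  qed
  have "(of_bool (verdict E g x \<eta>) :: real) = (\<Prod>e\<in>E. of_bool ((\<Prod>i\<in>e. u (Inl i)) = u (Inr e)))"
    using finite_E by (auto simp: verdict_def u_def vertices_of_def)
  also have "\<dots> = (\<Prod>e\<in>E. (?Z e + 1) / 2)" using Z by (intro prod.cong) auto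
  also have "\<dots> = (\<Sum>F\<in>Pow E. \<Prod>e\<in>F. ?Z e) / 2 ^ card E"
    using finite_E by (simp add: prod_dividef prod_add)
  also have "(\<Sum>F\<in>Pow E. \<Prod>e\<in>F. ?Z e) = (\<Sum>F\<in>Pow E. \<Prod>a\<in>odd_vertices F <+> F. u a)"
  proof (rule sum.cong)
    fix F assume "F \<in> Pow E"
    then have F: "F \<subseteq> E" "finite F" using finite_E finite_subset by auto
    have "(\<Prod>a\<in>odd_vertices F <+> F. u a) = (\<Prod>i\<in>odd_vertices F. u (Inl i)) * (\<Prod>e\<in>F. u (Inr e))"
      using F by (subst prod.Plus) (auto simp: odd_vertices_def)
    then show "(\<Prod>e\<in>F. ?Z e) = (\<Prod>a\<in>odd_vertices F <+> F. u a)"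
      using prod_edges[OF F(1), of "\<lambda>i. u (Inl i)"] uv by (simp add: prod.distrib)
  qed simp
  finally show ?thesis by (simp add: u_def)
qed

text \<open>Different oracles receive independent noise, so the expectation of each product is the
  product of the noise operators.\<close>

lemma acc_prob_eq_sum:
  assumes g: "admissible n ({1..t} <+> E) g"
  shows "acc_prob (noisy_H_test t E \<gamma>) n g = (\<Sum>F\<in>Pow E.
    avg (config t n) (\<lambda>x. \<Prod>a\<in>odd_vertices F <+> F. noise_op n \<gamma> (g a) (\<Sum>i\<in>vertices_of a. x i))) / 2 ^ card E"
proof -
  let ?N = "measure_pmf.expectation (noise_config t E \<gamma> n)"
  have expand: "?N (\<lambda>\<eta>. of_bool (verdict E g x \<eta>)) =
      (\<Sum>F\<in>Pow E. \<Prod>a\<in>odd_vertices F <+> F. noise_op n \<gamma> (g a) (\<Sum>i\<in>vertices_of a. x i)) / 2 ^ card E"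
    if x: "x \<in> config t n" for x
  proof -
    have "?N (\<lambda>\<eta>. of_bool (verdict E g x \<eta>)) = ?N (\<lambda>\<eta>. (\<Sum>F\<in>Pow E.
        \<Prod>a\<in>odd_vertices F <+> F. g a (\<eta> a + (\<Sum>i\<in>vertices_of a. x i))) / 2 ^ card E)"
      by (rule integral_cong_AE)
        (simp_all add: AE_measure_pmf_iff of_bool_verdict[OF g x] del: One_nat_def)
    also have "\<dots> = (\<Sum>F\<in>Pow E. ?N (\<lambda>\<eta>.
        \<Prod>a\<in>odd_vertices F <+> F. g a (\<eta> a + (\<Sum>i\<in>vertices_of a. x i)))) / 2 ^ card E"
      by (simp add: integrable_noise_config del: One_nat_def)
    also have "(\<Sum>F\<in>Pow E. ?N (\<lambda>\<eta>. \<Prod>a\<in>odd_vertices F <+> F. g a (\<eta> a + (\<Sum>i\<in>vertices_of a. x i)))) =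
        (\<Sum>F\<in>Pow E. \<Prod>a\<in>odd_vertices F <+> F. noise_op n \<gamma> (g a) (\<Sum>i\<in>vertices_of a. x i))"
    proof (rule sum.cong)
      fix F assume "F \<in> Pow E"
      then have sub: "odd_vertices F <+> F \<subseteq> {1..t} <+> E" by (auto simp: odd_vertices_def)
      \<comment> \<open>Oracles absent from the product are padded with 1, so that it ranges over
        all coordinates of the noise.\<close>
      let ?f = "\<lambda>a y. if a \<in> odd_vertices F <+> F then g a (y + (\<Sum>i\<in>vertices_of a. x i)) else 1"
      have "?N (\<lambda>\<eta>. \<Prod>a\<in>odd_vertices F <+> F. g a (\<eta> a + (\<Sum>i\<in>vertices_of a. x i))) =
          ?N (\<lambda>\<eta>. \<Prod>a\<in>{1..t} <+> E. ?f a (\<eta> a))"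
        using sub finite_oracles
        by (intro Bochner_Integration.integral_cong refl prod.mono_neutral_cong_left) auto
      also have "\<dots> = (\<Prod>a\<in>{1..t} <+> E. measure_pmf.expectation (noise n \<gamma>) (?f a))"
        using finite_oracles by (rule expectation_prod_Pi_pmf_finite) simp
      also have "\<dots> = (\<Prod>a\<in>odd_vertices F <+> F. noise_op n \<gamma> (g a) (\<Sum>i\<in>vertices_of a. x i))"
        using sub finite_oracles
        by (intro prod.mono_neutral_cong_right) (auto simp: noise_op_def)
      finally show "?N (\<lambda>\<eta>. \<Prod>a\<in>odd_vertices F <+> F. g a (\<eta> a + (\<Sum>i\<in>vertices_of a. x i))) = \<dots>" .
    qed simp
    finally show ?thesis .
  qed
  have "acc_prob (noisy_H_test t E \<gamma>) n g = avg (config t n) (\<lambda>x. (\<Sum>F\<in>Pow E.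
      \<Prod>a\<in>odd_vertices F <+> F. noise_op n \<gamma> (g a) (\<Sum>i\<in>vertices_of a. x i)) * (1 / 2 ^ card E))"
    unfolding acc_prob_noisy_H_test using expand by (intro avg_cong) simp
  then show ?thesis by (simp only: avg_multc avg_sum) simp
qed

section \<open>Soundness: nonempty sets of edges contribute little\<close>

lemma avg_prod_noise_op_bound:
  assumes card2: "\<And>e. e \<in> E \<Longrightarrow> 2 \<le> card e" and \<gamma>: "0 < \<gamma>" "\<gamma> < 1 / 2"
    and g: "admissible n ({1..t} <+> E) g"
    and F: "F \<subseteq> E" "F \<noteq> {}" and \<sigma>: "0 < \<sigma>"
    and d: "((1 - 2 * \<gamma>)\<^sup>2) ^ d \<le> \<sigma>\<^sup>2 / 2"
    and small: "\<And>k b c. k \<in> {1..n} \<Longrightarrow> b \<in> {1..t} <+> E \<Longrightarrow> c \<in> {1..t} <+> E \<Longrightarrow> b \<noteq> c \<Longrightarrow>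
      min (Infl n d k (g b)) (Infl n d k (g c)) \<le> \<sigma>\<^sup>2 / 2"
  shows "\<bar>avg (config t n) (\<lambda>x. \<Prod>a\<in>odd_vertices F <+> F. noise_op n \<gamma> (g a) (\<Sum>i\<in>vertices_of a. x i))\<bar>
    \<le> 2 ^ (t + card E) * (\<sigma> * (real (t + card E) * (1 / (1 - (1 - 2 * \<gamma>)\<^sup>2))))"
proof -
  let ?J = "odd_vertices F <+> F" and ?C = "1 / (1 - (1 - 2 * \<gamma>)\<^sup>2)"
  have sub: "?J \<subseteq> {1..t} <+> E" using F by (auto simp: odd_vertices_def)
  have cardJ: "card ?J \<le> t + card E"
    using card_mono[OF finite_oracles sub] finite_E by (simp add: card_Plus)
  have g1: "\<bar>g a x\<bar> \<le> 1" if "a \<in> {1..t} <+> E" "x \<in> cube n" for a x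
  proof -
    have "g a x \<in> {-1, 1}" using g that unfolding admissible_def by blast
    then show ?thesis by auto
  qed
  interpret linear_forms t n ?J vertices_of
  proof
    show "finite ?J" using sub finite_oracles finite_subset by blast
    show "vertices_of a \<subseteq> {1..t}" if "a \<in> ?J" for a
      using that sub by (intro vertices_of_subset) blast
    show "vertices_of a \<noteq> {}" if "a \<in> ?J" for a
      using that F card2 by (fastforce simp: vertices_of_def)
    \<comment> \<open>Edges with at least two vertices differ from the singletons of vertex oracles,
      so all linear forms are distinct.\<close>
    have "F \<inter> range (\<lambda>i. {i}) = {}" using F card2 by fastforce
    then show "inj_on vertices_of ?J" by (auto simp: inj_on_def vertices_of_def)
  qed
  \<comment> \<open>An edge oracle always survives in the product, unlike the vertex oracles; it is
    the balanced factor to be replaced by its mean.\<close>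
  obtain e0 where e0: "e0 \<in> F" using F by blast
  have J: "Inr e0 \<in> ?J" using e0 by auto
  have "avg (cube n) (g (Inr e0)) = 0"
    using g J sub unfolding admissible_def balanced_def expectation_uniform by blast
  then have bal: "avg (cube n) (noise_op n \<gamma> (g (Inr e0))) = 0"
    using \<gamma> by (simp add: avg_noise_op)
  \<comment> \<open>Half of \<open>\<sigma>\<^sup>2\<close> is reserved for the high-degree tail;
    the other half is the bound on the smaller low-degree influence in a pair.\<close>
  have infl: "influence n k (noise_op n \<gamma> (g a)) \<le> Infl n d k (g a) + \<sigma>\<^sup>2 / 2"
    if "k \<in> {1..n}" "a \<in> ?J" for k a
  proof -
    have "influence n k (noise_op n \<gamma> (g a)) \<le> Infl n d k (g a) + ((1 - 2 * \<gamma>)\<^sup>2) ^ d"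
      using \<gamma> that sub by (intro influence_noise_op_le g1) auto
    then show ?thesis using d by linarith
  qed
  have "\<bar>avg (config t n) (\<lambda>x. \<Prod>a\<in>?J. noise_op n \<gamma> (g a) (lin a x))\<bar>
      \<le> 2 ^ card ?J * (\<sigma> * (\<Sum>a\<in>?J. \<Sum>k=1..n. influence n k (noise_op n \<gamma> (g a))))"
  proof (rule avg_prod_bound[where f = "\<lambda>a. noise_op n \<gamma> (g a)", OF J _ bal \<sigma>])
    show "\<bar>noise_op n \<gamma> (g a) x\<bar> \<le> 1" if "a \<in> ?J" "x \<in> cube n" for a x
      using that sub by (intro noise_op_bound g1) auto
    show "min (influence n k (noise_op n \<gamma> (g b))) (influence n k (noise_op n \<gamma> (g c))) \<le> \<sigma>\<^sup>2"
      if "k \<in> {1..n}" "b \<in> ?J" "c \<in> ?J" "b \<noteq> c" for k b c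
    proof -
      have "min (Infl n d k (g b)) (Infl n d k (g c)) \<le> \<sigma>\<^sup>2 / 2"
        using that sub by (intro small) blast+
      then show ?thesis
        using infl[OF that(1,2)] infl[OF that(1,3)] unfolding min_le_iff_disj by linarith
    qed
  qed
  also have "\<dots> \<le> 2 ^ (t + card E) * (\<sigma> * (\<Sum>a\<in>?J. ?C))"
    using \<sigma> \<gamma> cardJ sub
    by (intro mult_mono power_increasing mult_left_mono sum_mono total_influence_noise_op_le g1
        mult_nonneg_nonneg sum_nonneg influence_nonneg) auto
  also have "\<dots> \<le> 2 ^ (t + card E) * (\<sigma> * (real (t + card E) * ?C))"
  proof -
    have "(1 - 2 * \<gamma>)\<^sup>2 < 1" using \<gamma> by (simp add: abs_square_less_1)
    then have "real (card ?J) * ?C \<le> real (t + card E) * ?C"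
      using cardJ by (intro mult_right_mono) auto
    then show ?thesis using \<sigma> by (simp only: sum_constant) (intro mult_left_mono, auto)
  qed
  finally show ?thesis by (simp add: lin_def)
qed

text \<open>The empty set of edges contributes exactly \<open>1 / 2 ^ card E\<close>; all other
  terms together stay below the advantage \<open>\<epsilon>\<close> unless two oracles share an
  influential bit. The constants are fixed before \<open>n\<close> and the oracles.\<close>

lemma noisy_H_test_soundness:
  assumes card2: "\<And>e. e \<in> E \<Longrightarrow> 2 \<le> card e" and \<gamma>: "0 < \<gamma>" "\<gamma> < 1 / 2"
  shows "has_soundness ({1..t} <+> E) (noisy_H_test t E \<gamma>) (1 / 2 ^ card E)"
  unfolding has_soundness_def
proof (intro allI impI)
  fix \<epsilon> :: real assume \<epsilon>: "0 < \<epsilon>"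
  define r where "r = (1 - 2 * \<gamma>)\<^sup>2"
  have r: "0 \<le> r" "r < 1" using \<gamma> by (auto simp: r_def abs_square_less_1)
  \<comment> \<open>The summand 1 keeps \<open>M\<close> positive even when there are no oracles at
    all.\<close>
  define M where "M = 2 ^ (t + card E) * (real (t + card E) * (1 / (1 - r))) + 1"
  have "1 \<le> M" unfolding M_def using r by simp
  then have M: "0 < M" by simp
  \<comment> \<open>Chosen so that the error of a single term is at most
    \<open>\<epsilon> / 2\<close>.\<close>
  define \<sigma> where "\<sigma> = \<epsilon> / (2 * M)"
  have \<sigma>: "0 < \<sigma>" using \<epsilon> M by (simp add: \<sigma>_def)
  have "\<sigma> * M = \<epsilon> / 2" using M by (simp add: \<sigma>_def)
  moreover have "2 ^ (t + card E) * (\<sigma> * (real (t + card E) * (1 / (1 - r)))) = \<sigma> * (M - 1)"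
    by (simp add: M_def)
  ultimately have bound: "2 ^ (t + card E) * (\<sigma> * (real (t + card E) * (1 / (1 - r)))) \<le> \<epsilon> / 2"
    using \<sigma> by (simp add: right_diff_distrib)
  \<comment> \<open>The degree is chosen so large that the damping of sets above it fits into the
    reserved half of \<open>\<sigma>\<^sup>2\<close>.\<close>
  obtain d where "r ^ d < \<sigma>\<^sup>2 / 2"
    using real_arch_pow_inv[of "\<sigma>\<^sup>2 / 2" r] \<sigma> r by auto
  then have d: "((1 - 2 * \<gamma>)\<^sup>2) ^ d \<le> \<sigma>\<^sup>2 / 2" by (simp add: r_def)
  have "\<exists>k\<in>{1..n}. XInf n d k ({1..t} <+> E) g \<ge> \<sigma>\<^sup>2 / 2"
    if g: "admissible n ({1..t} <+> E) g"
      and acc: "acc_prob (noisy_H_test t E \<gamma>) n g \<ge> 1 / 2 ^ card E + \<epsilon>" for n g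
  proof (rule ccontr)
    assume contr: "\<not> ?thesis"
    let ?T = "\<lambda>F. avg (config t n)
      (\<lambda>x. \<Prod>a\<in>odd_vertices F <+> F. noise_op n \<gamma> (g a) (\<Sum>i\<in>vertices_of a. x i))"
    \<comment> \<open>Every pair of distinct oracles bounds the maximum \<open>XInf\<close> from
      below, so the negated conclusion transfers to each pair.\<close>
    have small: "min (Infl n d k (g b)) (Infl n d k (g c)) \<le> \<sigma>\<^sup>2 / 2"
      if "k \<in> {1..n}" "b \<in> {1..t} <+> E" "c \<in> {1..t} <+> E" "b \<noteq> c" for k b c
    proof -
      let ?S = "{min (Infl n d k (g j)) (Infl n d k (g h)) |j h.
        j \<in> {1..t} <+> E \<and> h \<in> {1..t} <+> E \<and> j \<noteq> h}"
      have "?S \<subseteq> (\<lambda>(j, h). min (Infl n d k (g j)) (Infl n d k (g h))) ` (({1..t} <+> E) \<times> ({1..t} <+> E))"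
        by auto
      then have "finite ?S" by (rule finite_subset) (use finite_oracles in blast)
      then have "min (Infl n d k (g b)) (Infl n d k (g c)) \<le> XInf n d k ({1..t} <+> E) g"
        unfolding XInf_def using that by (intro Max_ge) blast+
      then show ?thesis using contr that(1) by force
    qed
    have T: "?T F \<le> \<epsilon> / 2" if "F \<in> Pow E - {{}}" for F
    proof -
      have "\<bar>?T F\<bar> \<le> 2 ^ (t + card E) * (\<sigma> * (real (t + card E) * (1 / (1 - r))))"
        unfolding r_def using that by (intro avg_prod_noise_op_bound[OF card2 \<gamma> g _ _ \<sigma> d small]) auto
      then show ?thesis using bound by linarith
    qed
    have "(\<Sum>F\<in>Pow E. ?T F) = ?T {} + (\<Sum>F\<in>Pow E - {{}}. ?T F)"
      using finite_E by (intro sum.remove) auto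
    also have "?T {} = 1"
    proof -
      have "odd_vertices {} <+> {} = ({} :: (nat + nat set) set)" by (auto simp: odd_vertices_def)
      then show ?thesis by (simp only: prod.empty) (simp add: avg_const)
    qed
    \<comment> \<open>The empty set is put back into the index set to have \<open>2 ^ card E\<close>
      equal summands; after division the error is \<open>\<epsilon> / 2\<close>, strictly below the
      assumed advantage.\<close>
    also have "(\<Sum>F\<in>Pow E - {{}}. ?T F) \<le> (\<Sum>F\<in>Pow E. \<epsilon> / 2)"
    proof (rule order_trans)
      show "(\<Sum>F\<in>Pow E - {{}}. ?T F) \<le> (\<Sum>F\<in>Pow E - {{}}. \<epsilon> / 2)" by (intro sum_mono T)
      show "\<dots> \<le> (\<Sum>F\<in>Pow E. \<epsilon> / 2)" using finite_E \<epsilon> by (intro sum_mono2) auto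
    qed
    finally have "acc_prob (noisy_H_test t E \<gamma>) n g \<le> (1 + 2 ^ card E * (\<epsilon> / 2)) / 2 ^ card E"
      unfolding acc_prob_eq_sum[OF g] using finite_E
      by (intro divide_right_mono) (auto simp: card_Pow)
    also have "\<dots> = 1 / 2 ^ card E + \<epsilon> / 2" by (simp add: add_divide_distrib)
    finally show False using acc \<epsilon> by linarith
  qed
  then show "\<exists>\<tau>>0. \<exists>d. \<forall>n g. admissible n ({1..t} <+> E) g \<longrightarrow>
      acc_prob (noisy_H_test t E \<gamma>) n g \<ge> 1 / 2 ^ card E + \<epsilon> \<longrightarrow>
      (\<exists>i\<in>{1..n}. XInf n d i ({1..t} <+> E) g \<ge> \<tau>)"
    using \<sigma> by (intro exI[of _ "\<sigma>\<^sup>2 / 2"]) auto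
qed

end

theorem theorem27:
  fixes t :: nat and E :: "nat set set" and \<gamma> :: real
  assumes "E \<subseteq> Pow {1..t}"
    and "\<And>e. e \<in> E \<Longrightarrow> card e \<ge> 2"
    and "0 < \<gamma>" and "\<gamma> < 1 / 2"
  shows "long_code_test (t + card E) ({1..t} <+> E) (noisy_H_test t E \<gamma>)
           (1 - (real t + 1) * \<gamma> * real (card E)) (1 / 2 ^ card E)"
  unfolding long_code_test_def
  using assms finite_E[OF assms(1)] noisy_H_test_completeness[OF assms(1), of \<gamma>]
    noisy_H_test_soundness[OF assms(1), of \<gamma>]
  by (auto simp: card_Plus)

end
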